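(* Let $w$ be a weight on $\mathbb{R}^n$ and $M$ the Hardy–Littlewood maximal operator. (1) Let $1\le p<\infty$. If $M$ is bounded from $\mathcal M^{p}(\varphi,w)$ to $W\mathcal M^{p}(\varphi,w)$, then $w\in A(\mathcal M^{p}(\varphi))$. (2) Let $1<p<\infty$. If $w\in A(\mathcal M^{p}(\varphi))$ and $w(\cdot+a)\in A_{p,\mathrm{loc}}$ for some $a\in\mathbb{R}^n$, then $M$ is bounded on $\mathcal M^{p}(\varphi,w)$. (3) If $w\in A(\mathcal M^{1}(\varphi))$ and $w(\cdot+a)\in A_{1,\mathrm{loc}}$ for some $a\in\mathbb{R}^n$, then $M$ is bounded from $\mathcal M^{1}(\varphi,w)$ to $W\mathcal M^{1}(\varphi,w)$.
   Context: A weight is a nonnegative locally integrable function on $\mathbb{R}^n$. Let $\varphi$ be a function from the set of Euclidean balls of $\mathbb{R}^n$ to $(0,\infty)$; standing assumptions: $\varphi$ is doubling ($\varphi(2B)\le C\varphi(B)$) and reverse doubling (there are $\delta>0$, $C$ with $\varphi(B_1)/\varphi(B_2)\le C(|B_1|/|B_2|)^\delta$ for balls $B_1\subset B_2$), and characteristic functions of balls belong to $\mathcal M^{p}(\varphi,w)$. $\mathcal M^{p}(\varphi,w)$: measurable $f$ with $\|f\|_{\mathcal M^{p}(\varphi,w)}:=\sup_B\big(\varphi(B)^{-1}\int_B|f|^pw\big)^{1/p}<\infty$ (supremum over all balls); $W\mathcal M^{p}(\varphi,w)$: $\|f\|_{W\mathcal M^{p}(\varphi,w)}:=\sup_B\sup_{t>0}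 t\, w(\{x\in B:|f(x)|>t\})^{1/p}\varphi(B)^{-1/p}<\infty$. Köthe dual: $\|g\|_{X'}:=\sup\{\int|fg|:\|f\|_X\le1\}$. $A(\mathcal M^{p}(\varphi))$: weights with $\sup_B\|\chi_B\|_{\mathcal M^{p}(\varphi,w)}\|\chi_B\|_{\mathcal M^{p}(\varphi,w)'}/|B|<\infty$, over all balls. Fix $\kappa\in(0,1)$ and let $\mathcal B_{\kappa,\mathrm{loc}}$ be the balls $B$ with radius $r_B<\kappa|c_B|$ ($c_B$ the center). For $1<p<\infty$, $w\in A_{p,\mathrm{loc}}$ means $\sup_{B\in\mathcal B_{\kappa,\mathrm{loc}}} w(B)^{1/p}\big(\int_B w^{1-p'}\big)^{1/p'}/|B|<\infty$; $w\in A_{1,\mathrm{loc}}$ means $w(B)/|B|\le C\operatorname{ess\,inf}_B w$ for all $B\in\mathcal B_{\kappa,\mathrm{loc}}$. These classes do not depend on $\kappa$. *)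

theory Defs
  imports "HOL-Analysis.Analysis"
begin

definition enn_pow :: "real \<Rightarrow> ennreal \<Rightarrow> ennreal" where
  "enn_pow p x = (if x = \<infinity> then \<infinity> else ennreal (enn2real x powr p))"

definition weight :: "('a::euclidean_space \<Rightarrow> real) \<Rightarrow> bool" where
  "weight w \<longleftrightarrow> (\<forall>x. 0 \<le> w x) \<and> w \<in> borel_measurable lebesgue
     \<and> (\<forall>c r. set_integrable lebesgue (cball c r) w)"

definition wmeas :: "('a::euclidean_space \<Rightarrow> real) \<Rightarrow> 'a set \<Rightarrow> ennreal" where
  "wmeas w E = (\<integral>\<^sup>+ x\<in>E. ennreal (w x) \<partial>lebesgue)"

text \<open>Weighted Morrey norm of |f| (given as an ennreal-valued function);
  supremum over all open balls B = ball c r, r > 0.\<close>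
definition morrey_norm ::
  "real \<Rightarrow> ('a::euclidean_space set \<Rightarrow> real) \<Rightarrow> ('a \<Rightarrow> real) \<Rightarrow> ('a \<Rightarrow> ennreal) \<Rightarrow> ennreal" where
  "morrey_norm p \<phi> w g =
     (SUP (c, r) \<in> {(c, r). 0 < r}.
        enn_pow (1 / p) (ennreal (1 / \<phi> (ball c r)) *
          (\<integral>\<^sup>+ x\<in>ball c r. enn_pow p (g x) * ennreal (w x) \<partial>lebesgue)))"

definition weak_morrey_norm ::
  "real \<Rightarrow> ('a::euclidean_space set \<Rightarrow> real) \<Rightarrow> ('a \<Rightarrow> real) \<Rightarrow> ('a \<Rightarrow> ennreal) \<Rightarrow> ennreal" where
  "weak_morrey_norm p \<phi> w g =
     (SUP (c, r, t) \<in> {(c, r, t). 0 < r \<and> 0 < t}.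
        ennreal t * enn_pow (1 / p)
          (wmeas w {x \<in> ball c r. g x > ennreal t} * ennreal (1 / \<phi> (ball c r))))"

definition kothe_norm ::
  "(('a::euclidean_space \<Rightarrow> ennreal) \<Rightarrow> ennreal) \<Rightarrow> ('a \<Rightarrow> real) \<Rightarrow> ennreal" where
  "kothe_norm X g =
     (SUP f \<in> {f :: 'a \<Rightarrow> real. f \<in> borel_measurable lebesgue \<and> X (\<lambda>x. ennreal \<bar>f x\<bar>) \<le> 1}.
        \<integral>\<^sup>+ x. ennreal \<bar>f x * g x\<bar> \<partial>lebesgue)"

definition A_morrey ::
  "real \<Rightarrow> ('a::euclidean_space set \<Rightarrow> real) \<Rightarrow> ('a \<Rightarrow> real) \<Rightarrow> bool" where
  "A_morrey p \<phi> w \<longleftrightarrow> (\<exists>C::real. \<forall>c r. 0 < r \<longrightarrow>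
      morrey_norm p \<phi> w (\<lambda>x. ennreal (indicator (ball c r) x))
      * kothe_norm (morrey_norm p \<phi> w) (indicator (ball c r))
      \<le> ennreal C * emeasure lebesgue (ball c r))"

definition A_p_loc :: "real \<Rightarrow> real \<Rightarrow> ('a::euclidean_space \<Rightarrow> real) \<Rightarrow> bool" where
  "A_p_loc \<kappa> p w \<longleftrightarrow> (\<exists>C::real. \<forall>c r. 0 < r \<and> r < \<kappa> * norm c \<longrightarrow>
      enn_pow (1 / p) (wmeas w (ball c r)) *
      enn_pow (1 - 1 / p)
        (\<integral>\<^sup>+ x\<in>ball c r. (if w x = 0 then \<infinity> else ennreal (w x powr (1 - p / (p - 1)))) \<partial>lebesgue)
      \<le> ennreal C * emeasure lebesgue (ball c r))"

definition A_1_loc :: "real \<Rightarrow> ('a::euclidean_space \<Rightarrow> real) \<Rightarrow> bool" where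
  "A_1_loc \<kappa> w \<longleftrightarrow> (\<exists>C::real. \<forall>c r. 0 < r \<and> r < \<kappa> * norm c \<longrightarrow>
      (AE x in lebesgue. x \<in> ball c r \<longrightarrow>
         wmeas w (ball c r) \<le> ennreal C * emeasure lebesgue (ball c r) * ennreal (w x)))"

definition hl_max :: "('a::euclidean_space \<Rightarrow> real) \<Rightarrow> 'a \<Rightarrow> ennreal" where
  "hl_max f x = (SUP (c, r) \<in> {(c, r). 0 < r \<and> x \<in> ball c r}.
      (\<integral>\<^sup>+ y\<in>ball c r. ennreal \<bar>f y\<bar> \<partial>lebesgue) / emeasure lebesgue (ball c r))"

definition phi_admissible ::
  "real \<Rightarrow> ('a::euclidean_space set \<Rightarrow> real) \<Rightarrow> ('a \<Rightarrow> real) \<Rightarrow> bool" where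
  "phi_admissible p \<phi> w \<longleftrightarrow>
     (\<forall>c r. 0 < r \<longrightarrow> 0 < \<phi> (ball c r))
   \<and> (\<exists>C. \<forall>c r. 0 < r \<longrightarrow> \<phi> (ball c (2 * r)) \<le> C * \<phi> (ball c r))
   \<and> (\<exists>\<delta> C. 0 < \<delta> \<and> (\<forall>c1 r1 c2 r2. 0 < r1 \<longrightarrow> 0 < r2 \<longrightarrow> ball c1 r1 \<subseteq> ball c2 r2 \<longrightarrow>
        \<phi> (ball c1 r1) / \<phi> (ball c2 r2)
          \<le> C * (measure lebesgue (ball c1 r1) / measure lebesgue (ball c2 r2)) powr \<delta>))
   \<and> (\<forall>c r. 0 < r \<longrightarrow> morrey_norm p \<phi> w (\<lambda>x. ennreal (indicator (ball c r) x)) < \<infinity>)"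

definition M_bdd_weak :: "real \<Rightarrow> ('a::euclidean_space set \<Rightarrow> real) \<Rightarrow> ('a \<Rightarrow> real) \<Rightarrow> bool" where
  "M_bdd_weak p \<phi> w \<longleftrightarrow> (\<exists>C::real. \<forall>f. f \<in> borel_measurable lebesgue \<longrightarrow>
      morrey_norm p \<phi> w (\<lambda>x. ennreal \<bar>f x\<bar>) < \<infinity> \<longrightarrow>
      weak_morrey_norm p \<phi> w (hl_max f) \<le> ennreal C * morrey_norm p \<phi> w (\<lambda>x. ennreal \<bar>f x\<bar>))"

definition M_bdd :: "real \<Rightarrow> ('a::euclidean_space set \<Rightarrow> real) \<Rightarrow> ('a \<Rightarrow> real) \<Rightarrow> bool" where
  "M_bdd p \<phi> w \<longleftrightarrow> (\<exists>C::real. \<forall>f. f \<in> borel_measurable lebesgue \<longrightarrow>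
      morrey_norm p \<phi> w (\<lambda>x. ennreal \<bar>f x\<bar>) < \<infinity> \<longrightarrow>
      morrey_norm p \<phi> w (hl_max f) \<le> ennreal C * morrey_norm p \<phi> w (\<lambda>x. ennreal \<bar>f x\<bar>))"

end

theory Submission
  imports Defs
begin

text \<open>
  Necessity: \<open>hl_max f\<close> exceeds the average of \<open>f\<close> over \<open>B\<close> on all of \<open>B\<close>, so the weak bound tested
  on \<open>f\<close> controls the norm of the indicator of \<open>B\<close> times that average.

  Sufficiency: let \<open>B\<close> be a ball that is small relative to its distance from \<open>a\<close>. The averages over
  larger balls are controlled by \<open>A_morrey\<close>. The smaller balls lie in the range of the local
  Muckenhoupt condition, where \<open>w\<close> and its dual weight are doubling, so Vitali's covering lemma
  bounds the associated weighted maximal operators and Lerner's argument (or, for \<open>p = 1\<close>, a direct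
  comparison) passes to the unweighted one. A general ball is covered, up to \<open>a\<close>, by small balls
  arranged in dyadic annuli around \<open>a\<close>, and reverse doubling of \<open>\<phi>\<close> makes the resulting sum
  geometric.
\<close>

section \<open>Powers and quotients of extended nonnegative reals\<close>

lemma enn_pow_ennreal: "0 \<le> x \<Longrightarrow> enn_pow p (ennreal x) = ennreal (x powr p)"
  by (simp add: enn_pow_def)

lemma enn_pow_top [simp]: "enn_pow p top = top"
  by (simp add: enn_pow_def)

lemma enn_pow_0 [simp]: "enn_pow p 0 = 0"
  by (simp add: enn_pow_def)

lemma enn_pow_one_right [simp]: "enn_pow p 1 = 1"
  by (simp add: enn_pow_def)

lemma enn_pow_one_left [simp]: "enn_pow 1 x = x"
  by (cases x) (simp_all add: enn_pow_ennreal)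

lemma enn_pow_eq_0_iff [simp]: "enn_pow p x = 0 \<longleftrightarrow> x = 0"
  by (cases x) (auto simp: enn_pow_ennreal powr_gt_zero)

lemma enn_pow_eq_top_iff [simp]: "enn_pow p x = top \<longleftrightarrow> x = top"
  by (simp add: enn_pow_def)

lemma enn_pow_less_top_iff [simp]: "enn_pow p x < top \<longleftrightarrow> x < top"
  by (simp flip: top.not_eq_extremum)

lemma enn_pow_mono: "0 \<le> p \<Longrightarrow> x \<le> y \<Longrightarrow> enn_pow p x \<le> enn_pow p y"
  by (cases x; cases y) (auto simp: enn_pow_ennreal powr_mono2 top_unique)

lemma enn_pow_enn_pow: "enn_pow p (enn_pow q x) = enn_pow (p * q) x"
  by (cases x) (simp_all add: enn_pow_ennreal powr_powr mult.commute)

lemma enn_pow_inverse [simp]: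
  "p \<noteq> 0 \<Longrightarrow> enn_pow (1 / p) (enn_pow p x) = x" "p \<noteq> 0 \<Longrightarrow> enn_pow p (enn_pow (1 / p) x) = x"
  by (simp_all add: enn_pow_enn_pow)

lemma enn_pow_le_iff:
  assumes "0 < p"
  shows "enn_pow p x \<le> enn_pow p y \<longleftrightarrow> x \<le> y"
  using assms enn_pow_mono[of p x y] enn_pow_mono[of "1/p" "enn_pow p x" "enn_pow p y"] by auto

lemma enn_pow_root_le_iff:
  assumes "0 < p"
  shows "enn_pow (1 / p) x \<le> y \<longleftrightarrow> x \<le> enn_pow p y"
  using assms enn_pow_le_iff[of p "enn_pow (1/p) x" y] by simp

lemma enn_pow_mult: "enn_pow p (x * y) = enn_pow p x * enn_pow p y"
proof (cases "x = top \<or> y = top")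
  case True
  then show ?thesis by (cases "x = 0 \<or> y = 0") (auto simp: ennreal_mult_top ennreal_top_mult)
next
  case False
  then obtain r s where "x = ennreal r" "0 \<le> r" "y = ennreal s" "0 \<le> s"
    by (cases x; cases y) auto
  then show ?thesis by (simp add: enn_pow_ennreal powr_mult flip: ennreal_mult)
qed

lemma enn_pow_add: "0 < p \<Longrightarrow> 0 < q \<Longrightarrow> enn_pow (p + q) x = enn_pow p x * enn_pow q x"
  by (cases x) (simp_all add: enn_pow_ennreal powr_add ennreal_mult')

lemma enn_pow_indicator [simp]: "enn_pow p (indicator A x) = indicator A x"
  by (auto simp: indicator_def)

lemma measurable_enn_pow [measurable]: "enn_pow p \<in> borel_measurable borel"
  unfolding enn_pow_def by measurable

lemma ennreal_mult_left_le_imp_le: "c * a \<le> c * b \<Longrightarrow> c \<noteq> 0 \<Longrightarrow> c < top \<Longrightarrow> a \<le> (b::ennreal)"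
  by (simp add: ennreal_mult_le_mult_iff)

lemma ennreal_divide_mult_cancel: "b \<noteq> 0 \<Longrightarrow> b < top \<Longrightarrow> a / b * b = (a::ennreal)"
  by (simp add: ennreal_divide_times)

lemma ennreal_le_divide_iff: "b \<noteq> 0 \<Longrightarrow> b < top \<Longrightarrow> a \<le> c / b \<longleftrightarrow> a * b \<le> (c::ennreal)"
  by (metis divide_less_ennreal linorder_not_le)

lemma ennreal_divide_le_iff:
  assumes "b \<noteq> 0" "b < (top::ennreal)"
  shows "a / b \<le> c \<longleftrightarrow> a \<le> c * b"
proof
  assume "a / b \<le> c"
  then have "a / b * b \<le> c * b" by (rule mult_right_mono) simp
  then show "a \<le> c * b" using assms by (simp add: ennreal_divide_mult_cancel)
next
  assume "a \<le> c * b"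
  then have "a / b \<le> c * b / b" by (rule divide_right_mono_ennreal)
  then show "a / b \<le> c" using assms by (simp add: ennreal_mult_divide_eq)
qed

lemma ennreal_divide_ennreal: "0 < u \<Longrightarrow> x / ennreal u = x * ennreal (1 / u)"
  by (simp add: divide_ennreal_def inverse_ennreal inverse_eq_divide)

lemma ennreal_mult_le_if_less_imp:
  fixes a c x :: ennreal
  assumes "x < top" "\<And>t. t < a \<Longrightarrow> t * x \<le> c"
  shows "a * x \<le> c"
proof (cases "x = 0")
  case False
  have "a \<le> c / x" by (rule dense_le) (simp add: ennreal_le_divide_iff False assms)
  then show ?thesis using False assms(1) by (simp add: ennreal_le_divide_iff)
qed simp

lemma ennreal_le_mult_if_greater_imp:
  fixes a b x :: ennreal
  assumes "b < top" "x < top" and le: "\<And>t. b < ennreal t \<Longrightarrow> a \<le> ennreal t * x"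
  shows "a \<le> b * x"
proof (cases "x = 0")
  case True
  obtain r where "b = ennreal r" "0 \<le> r" using assms(1) by (cases b) auto
  then show ?thesis using le[of "r + 1"] True by (simp add: ennreal_less_iff)
next
  case False
  have "a / x \<le> b"
  proof (rule dense_ge)
    fix t assume "b < t"
    then show "a / x \<le> t" using le False assms(2) by (cases t) (auto simp: ennreal_divide_le_iff)
  qed
  then show ?thesis using False assms(2) by (simp add: ennreal_divide_le_iff)
qed

lemma ennreal_one_divide_mult_le_iff: "0 < u \<Longrightarrow> ennreal (1 / u) * x \<le> y \<longleftrightarrow> x \<le> ennreal u * y"
  using ennreal_divide_le_iff[of "ennreal u" x y] by (simp add: ennreal_divide_ennreal mult.commute)

lemma Youngs_inequality_enn_pow:
  fixes a b :: ennreal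
  assumes "0 < \<theta>" "\<theta> < 1"
  shows "enn_pow \<theta> a * enn_pow (1 - \<theta>) b \<le> ennreal \<theta> * a + ennreal (1 - \<theta>) * b"
proof (cases "a = 0 \<or> b = 0 \<or> a = top \<or> b = top")
  case True
  then show ?thesis using assms by (auto simp: ennreal_mult_top)
next
  case False
  then obtain r s where rs: "a = ennreal r" "0 < r" "b = ennreal s" "0 < s"
    by (cases a; cases b) auto
  have "enn_pow \<theta> a * enn_pow (1 - \<theta>) b = ennreal (r powr \<theta> * s powr (1 - \<theta>))"
    using rs by (simp add: enn_pow_ennreal ennreal_mult)
  also have "\<dots> \<le> ennreal (\<theta> * r + (1 - \<theta>) * s)"
    using rs assms by (intro ennreal_leI Youngs_inequality_0) auto
  also have "\<dots> = ennreal \<theta> * a + ennreal (1 - \<theta>) * b"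
    using rs assms by (simp add: ennreal_mult ennreal_plus)
  finally show ?thesis .
qed

lemma enn_pow_mult_le_normalized:
  fixes u v U V :: ennreal
  assumes \<theta>: "0 < \<theta>" "\<theta> < 1" and U: "U \<noteq> 0" "U < top" and V: "V \<noteq> 0" "V < top"
  shows "enn_pow \<theta> u * enn_pow (1 - \<theta>) v
    \<le> enn_pow \<theta> U * enn_pow (1 - \<theta>) V * (ennreal \<theta> * (u / U) + ennreal (1 - \<theta>) * (v / V))"
proof -
  have "enn_pow \<theta> u * enn_pow (1 - \<theta>) v = enn_pow \<theta> (u / U * U) * enn_pow (1 - \<theta>) (v / V * V)"
    using U V by (simp add: ennreal_divide_mult_cancel)
  also have "\<dots> = enn_pow \<theta> U * enn_pow (1 - \<theta>) V * (enn_pow \<theta> (u / U) * enn_pow (1 - \<theta>) (v / V))"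
    by (simp add: enn_pow_mult ac_simps)
  finally show ?thesis using Youngs_inequality_enn_pow[OF \<theta>] by (simp add: mult_left_mono)
qed

lemma nn_integral_Holder:
  assumes [measurable]: "u \<in> borel_measurable M" "v \<in> borel_measurable M"
    and \<theta>: "0 < \<theta>" "\<theta> < 1"
  shows "(\<integral>\<^sup>+x. enn_pow \<theta> (u x) * enn_pow (1 - \<theta>) (v x) \<partial>M)
    \<le> enn_pow \<theta> (\<integral>\<^sup>+x. u x \<partial>M) * enn_pow (1 - \<theta>) (\<integral>\<^sup>+x. v x \<partial>M)"
proof -
  define U V where "U = (\<integral>\<^sup>+x. u x \<partial>M)" and "V = (\<integral>\<^sup>+x. v x \<partial>M)"
  consider "U = 0 \<or> V = 0" | "U \<noteq> 0" "V \<noteq> 0" "U = top \<or> V = top"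
    | "U \<noteq> 0" "V \<noteq> 0" "U < top" "V < top"
    by (metis top.not_eq_extremum)
  then show ?thesis
  proof cases
    case 1
    then have "AE x in M. enn_pow \<theta> (u x) * enn_pow (1 - \<theta>) (v x) = 0"
      unfolding U_def V_def by (auto simp: nn_integral_0_iff_AE)
    then show ?thesis by (subst nn_integral_cong_AE[of _ "\<lambda>_. 0"]) auto
  next
    case 2
    then show ?thesis by (auto simp: U_def V_def ennreal_mult_top ennreal_top_mult)
  next
    case 3
    let ?G = "enn_pow \<theta> U * enn_pow (1 - \<theta>) V"
    have "(\<integral>\<^sup>+x. enn_pow \<theta> (u x) * enn_pow (1 - \<theta>) (v x) \<partial>M)
        \<le> (\<integral>\<^sup>+x. ?G * (ennreal \<theta> * (u x / U) + ennreal (1 - \<theta>) * (v x / V)) \<partial>M)"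
      using 3 by (intro nn_integral_mono enn_pow_mult_le_normalized \<theta>)
    also have "\<dots> = ?G * (ennreal \<theta> * (U / U) + ennreal (1 - \<theta>) * (V / V))"
      by (simp add: nn_integral_cmult nn_integral_add nn_integral_divide U_def V_def)
    also have "\<dots> = ?G * (ennreal \<theta> + ennreal (1 - \<theta>))" using 3 by simp
    also have "ennreal \<theta> + ennreal (1 - \<theta>) = 1" using \<theta> by (simp flip: ennreal_plus)
    finally show ?thesis by (simp add: U_def V_def)
  qed
qed

section \<open>Maximal operators over families of balls\<close>

definition average :: "'a measure \<Rightarrow> 'a set \<Rightarrow> ('a \<Rightarrow> ennreal) \<Rightarrow> ennreal" where
  "average \<mu> B g = (\<integral>\<^sup>+y\<in>B. g y \<partial>\<mu>) / emeasure \<mu> B"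

lemma average_mono: "(\<And>y. y \<in> B \<Longrightarrow> f y \<le> g y) \<Longrightarrow> average \<mu> B f \<le> average \<mu> B g"
  unfolding average_def
  by (intro divide_right_mono_ennreal nn_integral_mono) (auto simp: indicator_def)

lemma nn_integral_abs_mult_indicator:
  "(\<integral>\<^sup>+x. ennreal \<bar>f x * indicator B x\<bar> \<partial>\<mu>) = (\<integral>\<^sup>+x\<in>B. ennreal \<bar>f x\<bar> \<partial>\<mu>)"
  by (intro nn_integral_cong) (simp add: indicator_def)

lemma average_mult_emeasure:
  "emeasure \<mu> B \<noteq> 0 \<Longrightarrow> emeasure \<mu> B < top \<Longrightarrow> average \<mu> B g * emeasure \<mu> B = (\<integral>\<^sup>+y\<in>B. g y \<partial>\<mu>)"
  by (simp add: average_def ennreal_divide_mult_cancel)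

lemma mult_emeasure_le_if_less_average:
  assumes "t < average \<mu> B g"
  shows "t * emeasure \<mu> B \<le> (\<integral>\<^sup>+y\<in>B. g y \<partial>\<mu>)"
proof (cases "emeasure \<mu> B = 0 \<or> emeasure \<mu> B = top")
  case True
  then show ?thesis using assms by (auto simp: average_def)
next
  case False
  then show ?thesis
    using assms by (simp add: average_def top.not_eq_extremum flip: ennreal_le_divide_iff)
qed

lemma average_le_average_truncation:
  assumes [measurable]: "g \<in> borel_measurable \<mu>" "B \<in> sets \<mu>"
  shows "average \<mu> B g \<le> average \<mu> B (\<lambda>x. g x * indicator {x. s < g x} x) + s"
proof -
  let ?h = "\<lambda>x. g x * indicator {x. s < g x} x"
  have "(\<integral>\<^sup>+y\<in>B. g y \<partial>\<mu>) \<le> (\<integral>\<^sup>+y. ?h y * indicator B y + s * indicator B y \<partial>\<mu>)"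
    by (intro nn_integral_mono) (auto simp: indicator_def)
  also have "\<dots> = (\<integral>\<^sup>+y\<in>B. ?h y \<partial>\<mu>) + s * emeasure \<mu> B"
    by (simp add: nn_integral_add nn_integral_cmult_indicator)
  finally have "average \<mu> B g \<le> ((\<integral>\<^sup>+y\<in>B. ?h y \<partial>\<mu>) + s * emeasure \<mu> B) / emeasure \<mu> B"
    unfolding average_def by (rule divide_right_mono_ennreal)
  also have "\<dots> = average \<mu> B ?h + s * (emeasure \<mu> B / emeasure \<mu> B)"
    by (simp add: average_def add_divide_distrib_ennreal ennreal_times_divide)
  also have "\<dots> \<le> average \<mu> B ?h + s * 1"
    by (intro add_left_mono mult_left_mono)
      (cases "emeasure \<mu> B = 0"; cases "emeasure \<mu> B = top"; auto simp flip: top.not_eq_extremum)+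
  finally show ?thesis by simp
qed

definition ball_maximal ::
  "'a::euclidean_space measure \<Rightarrow> ('a \<times> real) set \<Rightarrow> ('a \<Rightarrow> ennreal) \<Rightarrow> 'a \<Rightarrow> ennreal" where
  "ball_maximal \<mu> F g x
      = (SUP (c, r) \<in> {(c, r). (c, r) \<in> F \<and> x \<in> ball c r}. average \<mu> (ball c r) g)"

lemma hl_max_eq_ball_maximal: "hl_max f = ball_maximal lebesgue {(c, r). 0 < r} (\<lambda>y. ennreal \<bar>f y\<bar>)"
  unfolding hl_max_def ball_maximal_def average_def by (rule ext) simp

lemma less_ball_maximal_iff:
  "t < ball_maximal \<mu> F g x \<longleftrightarrow> (\<exists>c r. (c, r) \<in> F \<and> x \<in> ball c r \<and> t < average \<mu> (ball c r) g)"
  unfolding ball_maximal_def less_SUP_iff by auto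

lemma ball_maximal_le_iff:
  "ball_maximal \<mu> F g x \<le> t \<longleftrightarrow> (\<forall>c r. (c, r) \<in> F \<and> x \<in> ball c r \<longrightarrow> average \<mu> (ball c r) g \<le> t)"
  unfolding ball_maximal_def SUP_le_iff by auto

lemma average_le_ball_maximal:
  "(c, r) \<in> F \<Longrightarrow> x \<in> ball c r \<Longrightarrow> average \<mu> (ball c r) g \<le> ball_maximal \<mu> F g x"
  using ball_maximal_le_iff[of \<mu> F g x "ball_maximal \<mu> F g x"] by auto

lemma ball_maximal_superlevel:
  "{x. t < ball_maximal \<mu> F g x}
      = (\<Union>(c, r)\<in>{(c, r). (c, r) \<in> F \<and> t < average \<mu> (ball c r) g}. ball c r)"
  unfolding less_ball_maximal_iff by (auto simp: mem_ball) blast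

lemma open_ball_maximal_superlevel: "open {x. t < ball_maximal \<mu> F g x}"
  unfolding ball_maximal_superlevel by auto

lemma sets_ball_maximal_superlevel [simp]: "{x. t < ball_maximal \<mu> F g x} \<in> sets lebesgue"
  by (intro sets_completionI_sets lborelD borel_open open_ball_maximal_superlevel)

lemma borel_measurable_ball_maximal: "ball_maximal \<mu> F g \<in> borel_measurable borel"
  by (rule borel_measurableI_greater) (simp add: open_ball_maximal_superlevel)

lemma borel_measurable_ball_maximal_lebesgue [measurable]:
  "ball_maximal \<mu> F g \<in> borel_measurable (lebesgue :: 'a::euclidean_space measure)"
  using borel_measurable_ball_maximal[of \<mu> F g] by (intro measurable_completion) simp

lemma borel_measurable_hl_max [measurable]: "hl_max f \<in> borel_measurable lebesgue"
  unfolding hl_max_eq_ball_maximal by measurable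

lemma emeasure_UN_le_nn_integral_count_space:
  assumes I: "countable I" and A[measurable]: "\<And>i. i \<in> I \<Longrightarrow> A i \<in> sets M"
  shows "emeasure M (\<Union>i\<in>I. A i) \<le> (\<integral>\<^sup>+i. emeasure M (A i) \<partial>count_space I)"
proof -
  have "emeasure M (\<Union>i\<in>I. A i) = (\<integral>\<^sup>+x. indicator (\<Union>i\<in>I. A i) x \<partial>M)"
    using I A by (intro nn_integral_indicator[symmetric] sets.countable_UN') auto
  also have "\<dots> \<le> (\<integral>\<^sup>+x. (\<integral>\<^sup>+i. indicator (A i) x \<partial>count_space I) \<partial>M)"
  proof (rule nn_integral_mono)
    fix x
    have "1 \<le> (\<integral>\<^sup>+i. indicator (A i) x \<partial>count_space I)" if "i \<in> I" "x \<in> A i" for i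
      using nn_integral_ge_point[OF that(1), of "\<lambda>i. indicator (A i) x"] that(2) by simp
    then show "indicator (\<Union>i\<in>I. A i) x \<le> (\<integral>\<^sup>+i. indicator (A i) x \<partial>count_space I)"
      by (auto simp: indicator_def)
  qed
  also have "\<dots> = (\<integral>\<^sup>+i. (\<integral>\<^sup>+x. indicator (A i) x \<partial>M) \<partial>count_space I)"
    using I by (intro nn_integral_count_space_nn_integral) auto
  also have "\<dots> = (\<integral>\<^sup>+i. emeasure M (A i) \<partial>count_space I)"
    by (intro nn_integral_cong) simp
  finally show ?thesis .
qed

text \<open>The factor \<open>5\<close> is the one of Vitali's covering lemma.\<close>

locale doubling_family =
  fixes \<mu> :: "'a::euclidean_space measure" and F :: "('a \<times> real) set" and R :: real and D :: ennreal
  assumes sets_eq: "sets \<mu> = sets lebesgue"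
    and radius: "\<And>c r. (c, r) \<in> F \<Longrightarrow> 0 < r \<and> r \<le> R"
    and doubling: "\<And>c r. (c, r) \<in> F \<Longrightarrow> emeasure \<mu> (ball c (5 * r)) \<le> D * emeasure \<mu> (ball c r)"
begin

lemma space_eq_UNIV: "space \<mu> = UNIV"
  using sets_eq_imp_space_eq[OF sets_eq] by simp

lemma measurable_eq_lebesgue: "borel_measurable \<mu> = borel_measurable lebesgue"
  by (rule measurable_cong_sets[OF sets_eq refl])

lemma sets_ball [measurable]: "ball c r \<in> sets \<mu>"
  unfolding sets_eq by simp

lemma mult_emeasure_UN_balls_le:
  assumes "K \<subseteq> F" and \<nu>: "sets \<nu> = sets lebesgue"
    and le: "\<And>c r. (c, r) \<in> K \<Longrightarrow> t * emeasure \<mu> (ball c r) \<le> emeasure \<nu> (ball c r)"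
  shows "t * emeasure \<mu> (\<Union>(c, r)\<in>K. ball c r) \<le> D * emeasure \<nu> UNIV"
proof -
  let ?B = "\<lambda>i::'a \<times> real. ball (fst i) (snd i)" and ?B5 = "\<lambda>i::'a \<times> real. ball (fst i) (5 * snd i)"
  have ball_\<nu>: "ball c r \<in> sets \<nu>" for c r unfolding \<nu> by simp
  have "(\<Union>(c, r)\<in>K. ball c r) \<subseteq> (\<Union>i\<in>K. ?B i)" by auto
  moreover have "0 < snd i \<and> snd i \<le> R" if "i \<in> K" for i
    using radius[of "fst i" "snd i"] that assms(1) by auto
  ultimately obtain J where J: "countable J" "J \<subseteq> K"
    and disjoint: "pairwise (\<lambda>i j. disjnt (?B i) (?B j)) J"
    and cover: "(\<Union>(c, r)\<in>K. ball c r) \<subseteq> (\<Union>i\<in>J. ?B5 i)"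
    by (rule Vitali_covering_lemma_balls) (auto intro: that)
  have "t * emeasure \<mu> (\<Union>(c, r)\<in>K. ball c r) \<le> t * emeasure \<mu> (\<Union>i\<in>J. ?B5 i)"
    using J by (intro mult_left_mono emeasure_mono cover sets.countable_UN') auto
  also have "\<dots> \<le> t * (\<integral>\<^sup>+i. emeasure \<mu> (?B5 i) \<partial>count_space J)"
    by (intro mult_left_mono emeasure_UN_le_nn_integral_count_space J) auto
  also have "\<dots> = (\<integral>\<^sup>+i. t * emeasure \<mu> (?B5 i) \<partial>count_space J)"
    by (simp add: nn_integral_cmult)
  also have "\<dots> \<le> (\<integral>\<^sup>+i. D * emeasure \<nu> (?B i) \<partial>count_space J)"
  proof (rule nn_integral_mono)
    fix i assume "i \<in> space (count_space J)"
    then have i: "(fst i, snd i) \<in> K" using J(2) by auto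
    then have "t * emeasure \<mu> (?B5 i) \<le> t * (D * emeasure \<mu> (?B i))"
      using assms(1) by (intro mult_left_mono doubling) auto
    also have "\<dots> \<le> D * emeasure \<nu> (?B i)"
      using mult_left_mono[OF le[OF i], of D] by (simp add: ac_simps)
    finally show "t * emeasure \<mu> (?B5 i) \<le> D * emeasure \<nu> (?B i)" .
  qed
  also have "\<dots> = D * emeasure \<nu> (\<Union>i\<in>J. ?B i)"
    using disjoint J(1) ball_\<nu>
    by (subst emeasure_UN_countable)
      (auto simp: nn_integral_cmult disjoint_family_on_def pairwise_def disjnt_def)
  also have "\<dots> \<le> D * emeasure \<nu> UNIV"
    using emeasure_space[of \<nu> "\<Union>i\<in>J. ?B i"] sets_eq_imp_space_eq[OF \<nu>] by (simp add: mult_left_mono)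
  finally show ?thesis .
qed

lemma weak_type:
  assumes "g \<in> borel_measurable lebesgue"
  shows "t * emeasure \<mu> {x. t < ball_maximal \<mu> F g x} \<le> D * (\<integral>\<^sup>+x. g x \<partial>\<mu>)"
proof -
  have [measurable]: "g \<in> borel_measurable \<mu>" using assms by (simp add: measurable_eq_lebesgue)
  have "t * emeasure \<mu> {x. t < ball_maximal \<mu> F g x} \<le> D * emeasure (density \<mu> g) UNIV"
    unfolding ball_maximal_superlevel
  proof (rule mult_emeasure_UN_balls_le)
    fix c r assume "(c, r) \<in> {(c, r). (c, r) \<in> F \<and> t < average \<mu> (ball c r) g}"
    then show "t * emeasure \<mu> (ball c r) \<le> emeasure (density \<mu> g) (ball c r)"
      by (simp add: emeasure_density mult_emeasure_le_if_less_average)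
  qed (auto simp: sets_eq)
  also have "emeasure (density \<mu> g) UNIV = (\<integral>\<^sup>+x. g x \<partial>\<mu>)"
    using sets.top[of \<mu>] by (simp add: emeasure_density space_eq_UNIV)
  finally show ?thesis .
qed

lemma ball_maximal_le_truncation:
  assumes "g \<in> borel_measurable lebesgue"
  shows "ball_maximal \<mu> F g x \<le> ball_maximal \<mu> F (\<lambda>x. g x * indicator {x. s < g x} x) x + s"
  unfolding ball_maximal_le_iff
proof (intro allI impI)
  fix c r assume "(c, r) \<in> F \<and> x \<in> ball c r"
  moreover have "average \<mu> (ball c r) g
      \<le> average \<mu> (ball c r) (\<lambda>x. g x * indicator {x. s < g x} x) + s"
    using assms by (intro average_le_average_truncation) (auto simp: measurable_eq_lebesgue)
  ultimately show "average \<mu> (ball c r) g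
      \<le> ball_maximal \<mu> F (\<lambda>x. g x * indicator {x. s < g x} x) x + s"
    using average_le_ball_maximal by (meson add_right_mono order_trans)
qed

lemma weak_type_truncation:
  assumes g[measurable]: "g \<in> borel_measurable lebesgue"
  shows "s * emeasure \<mu> {x. s + s < ball_maximal \<mu> F g x}
    \<le> D * (\<integral>\<^sup>+x. g x * indicator {x. s < g x} x \<partial>\<mu>)"
proof -
  let ?h = "\<lambda>x. g x * indicator {x. s < g x} x"
  have "{x. s + s < ball_maximal \<mu> F g x} \<subseteq> {x. s < ball_maximal \<mu> F ?h x}"
  proof safe
    fix x assume "s + s < ball_maximal \<mu> F g x"
    then have "s + s < ball_maximal \<mu> F ?h x + s"
      by (rule less_le_trans) (rule ball_maximal_le_truncation[OF g])
    then show "s < ball_maximal \<mu> F ?h x" by (meson add_right_mono not_le)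
  qed
  then have "s * emeasure \<mu> {x. s + s < ball_maximal \<mu> F g x}
      \<le> s * emeasure \<mu> {x. s < ball_maximal \<mu> F ?h x}"
    by (intro mult_left_mono emeasure_mono) (auto simp: sets_eq)
  also have "\<dots> \<le> D * (\<integral>\<^sup>+x. ?h x \<partial>\<mu>)" by (intro weak_type) measurable
  finally show ?thesis .
qed

end

lemma nn_integral_powr_segment:
  assumes "0 < q" "0 \<le> u"
  shows "(\<integral>\<^sup>+t. ennreal (q * t powr (q - 1)) * indicator {0<..<u} t \<partial>lborel) = ennreal (u powr q)"
proof -
  have "((\<lambda>t. q * t powr (q - 1)) has_integral (q * (u powr (q - 1 + 1) / (q - 1 + 1)))) {0..u}"
    using assms by (intro has_integral_mult_right has_integral_powr_from_0) auto
  then have "(\<integral>\<^sup>+t. ennreal (indicator {0..u} t * (q * t powr (q - 1))) \<partial>lborel)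
      = ennreal (u powr q)"
    using assms by (intro nn_integral_has_integral_lebesgue) auto
  also have "(\<integral>\<^sup>+t. ennreal (indicator {0..u} t * (q * t powr (q - 1))) \<partial>lborel)
      = (\<integral>\<^sup>+t. ennreal (q * t powr (q - 1)) * indicator {0<..<u} t \<partial>lborel)"
    using AE_lborel_singleton[of u] AE_lborel_singleton[of 0]
    by (intro nn_integral_cong_AE) (auto elim!: eventually_rev_mp simp: indicator_def)
  finally show ?thesis .
qed

lemma enn_pow_layer_cake:
  assumes q: "0 < q"
  shows "enn_pow q y
    = (\<integral>\<^sup>+t. ennreal (q * t powr (q - 1)) * indicator {t. 0 < t \<and> ennreal t < y} t \<partial>lborel)"
    (is "_ = ?I y")
proof -
  have finite: "?I (ennreal u) = ennreal (u powr q)" if "0 \<le> u" for u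
    unfolding nn_integral_powr_segment[OF q that, symmetric]
    by (intro nn_integral_cong) (auto simp: indicator_def ennreal_less_iff)
  show ?thesis
  proof (cases y)
    case (real u)
    then show ?thesis using finite[of u] by (simp add: enn_pow_ennreal)
  next
    case top
    have unbounded: "ennreal b \<le> ?I top" if "0 \<le> b" for b
    proof -
      have "ennreal b = ?I (ennreal (b powr (1 / q)))"
        using q that by (subst finite) (auto simp: powr_powr)
      also have "\<dots> \<le> ?I top" by (intro nn_integral_mono) (auto simp: indicator_def)
      finally show ?thesis .
    qed
    have "?I top = top"
    proof (cases "?I top")
      case (real b)
      then show ?thesis using unbounded[of "b + 1"] by simp
    qed
    then show ?thesis using top by simp
  qed
qed

lemma (in sigma_finite_measure) nn_integral_mult_enn_pow_layer_cake:
  assumes [measurable]: "k \<in> borel_measurable M" "f \<in> borel_measurable M" and q: "0 < q"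
  shows "(\<integral>\<^sup>+x. k x * enn_pow q (f x) \<partial>M)
    = (\<integral>\<^sup>+t. ennreal (q * t powr (q - 1)) * indicator {0<..} t
        * (\<integral>\<^sup>+x. k x * indicator {x. ennreal t < f x} x \<partial>M) \<partial>lborel)"
proof -
  interpret pair_sigma_finite M "lborel :: real measure" ..
  have "(\<integral>\<^sup>+x. k x * enn_pow q (f x) \<partial>M) = (\<integral>\<^sup>+x. (\<integral>\<^sup>+t. k x *
      (ennreal (q * t powr (q - 1)) * indicator {t. 0 < t \<and> ennreal t < f x} t) \<partial>lborel) \<partial>M)"
    by (intro nn_integral_cong) (simp add: enn_pow_layer_cake[OF q] nn_integral_cmult)
  also have "\<dots> = (\<integral>\<^sup>+t. (\<integral>\<^sup>+x. k x *
      (ennreal (q * t powr (q - 1)) * indicator {t. 0 < t \<and> ennreal t < f x} t) \<partial>M) \<partial>lborel)"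
    by (rule Fubini'[symmetric]) measurable
  also have "\<dots> = (\<integral>\<^sup>+t. (\<integral>\<^sup>+x. (ennreal (q * t powr (q - 1)) * indicator {0<..} t) *
      (k x * indicator {x. ennreal t < f x} x) \<partial>M) \<partial>lborel)"
    by (intro nn_integral_cong) (auto simp: indicator_def ac_simps)
  finally show ?thesis by (simp add: nn_integral_cmult)
qed

lemma (in sigma_finite_measure) nn_integral_enn_pow_le_if_superlevel_le:
  assumes f[measurable]: "f \<in> borel_measurable M" and h[measurable]: "h \<in> borel_measurable M"
    and q: "1 < q"
    and level: "\<And>t. 0 < t \<Longrightarrow> ennreal t * emeasure M {x \<in> space M. ennreal t < f x}
      \<le> A * (\<integral>\<^sup>+x. h x * indicator {x. ennreal t < h x} x \<partial>M)"
  shows "(\<integral>\<^sup>+x. enn_pow q (f x) \<partial>M) \<le> ennreal (q / (q - 1)) * A * (\<integral>\<^sup>+x. enn_pow q (h x) \<partial>M)"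
proof -
  let ?H = "\<lambda>t. (\<integral>\<^sup>+x. h x * indicator {x. ennreal t < h x} x \<partial>M)"
  have "(\<integral>\<^sup>+x. enn_pow q (f x) \<partial>M) = (\<integral>\<^sup>+t. ennreal (q * t powr (q - 1)) * indicator {0<..} t
      * emeasure M {x \<in> space M. ennreal t < f x} \<partial>lborel)"
    using nn_integral_mult_enn_pow_layer_cake[of "\<lambda>_. 1" f q] q
    by (simp flip: nn_integral_indicator) (simp add: indicator_def cong: nn_integral_cong)
  also have "\<dots> \<le> (\<integral>\<^sup>+t. (ennreal (q / (q - 1)) * A) *
      (ennreal ((q - 1) * t powr (q - 1 - 1)) * indicator {0<..} t * ?H t) \<partial>lborel)"
  proof (rule nn_integral_mono)
    fix t :: real
    show "ennreal (q * t powr (q - 1)) * indicator {0<..} t *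
        emeasure M {x \<in> space M. ennreal t < f x}
      \<le> (ennreal (q / (q - 1)) * A) *
        (ennreal ((q - 1) * t powr (q - 1 - 1)) * indicator {0<..} t * ?H t)"
    proof (cases "0 < t")
      case True
      let ?c = "ennreal (q / (q - 1)) * ennreal ((q - 1) * t powr (q - 1 - 1))"
      have "ennreal (q * t powr (q - 1)) = ?c * ennreal t"
        using True q powr_add[of t "q - 1 - 1" 1] by (simp flip: ennreal_mult)
      then have "ennreal (q * t powr (q - 1)) * emeasure M {x \<in> space M. ennreal t < f x}
          = ?c * (ennreal t * emeasure M {x \<in> space M. ennreal t < f x})"
        by (simp add: mult.assoc)
      also have "\<dots> \<le> ?c * (A * ?H t)" by (rule mult_left_mono[OF level[OF True]]) simp
      finally show ?thesis using True by (simp add: ac_simps)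
    qed simp
  qed
  also have "\<dots> = ennreal (q / (q - 1)) * A * (\<integral>\<^sup>+x. h x * enn_pow (q - 1) (h x) \<partial>M)"
    using q by (simp add: nn_integral_cmult nn_integral_mult_enn_pow_layer_cake)
  also have "(\<integral>\<^sup>+x. h x * enn_pow (q - 1) (h x) \<partial>M) = (\<integral>\<^sup>+x. enn_pow q (h x) \<partial>M)"
    using q enn_pow_add[of 1 "q - 1"] by simp
  finally show ?thesis .
qed

definition strong_type_const :: "real \<Rightarrow> ennreal \<Rightarrow> ennreal" where
  "strong_type_const q D = ennreal (q / (q - 1)) * D * enn_pow q 2"

lemma (in doubling_family) strong_type:
  assumes "sigma_finite_measure \<mu>" and g[measurable]: "g \<in> borel_measurable lebesgue" and q: "1 < q"
  shows "(\<integral>\<^sup>+x. enn_pow q (ball_maximal \<mu> F g x) \<partial>\<mu>)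
    \<le> strong_type_const q D * (\<integral>\<^sup>+x. enn_pow q (g x) \<partial>\<mu>)"
proof -
  interpret sigma_finite_measure \<mu> by fact
  have [measurable]: "g \<in> borel_measurable \<mu>" "ball_maximal \<mu> F g \<in> borel_measurable \<mu>"
    using g by (simp_all add: measurable_eq_lebesgue)
  have "(\<integral>\<^sup>+x. enn_pow q (ball_maximal \<mu> F g x) \<partial>\<mu>)
      \<le> ennreal (q / (q - 1)) * D * (\<integral>\<^sup>+x. enn_pow q (2 * g x) \<partial>\<mu>)"
  proof (rule nn_integral_enn_pow_le_if_superlevel_le)
    fix t :: real assume t: "0 < t"
    define s where "s = ennreal (t / 2)"
    have t_eq: "ennreal t = s + s"
      unfolding s_def using t by (subst ennreal_plus[symmetric]) auto
    have "s + s < 2 * y \<longleftrightarrow> s < y" for y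
      using ennreal_mult_le_mult_iff[of 2 y s] by (simp flip: mult_2 not_le)
    then have level: "2 * g x * indicator {x. s + s < 2 * g x} x
        = 2 * (g x * indicator {x. s < g x} x)" for x
      by (simp add: indicator_def)
    have "(s + s) * emeasure \<mu> {x. s + s < ball_maximal \<mu> F g x}
        \<le> 2 * (D * (\<integral>\<^sup>+x. g x * indicator {x. s < g x} x \<partial>\<mu>))"
      using mult_left_mono[OF weak_type_truncation[OF g, of s], of 2]
      by (simp add: mult.assoc flip: mult_2)
    also have "\<dots> = D * (\<integral>\<^sup>+x. 2 * g x * indicator {x. s + s < 2 * g x} x \<partial>\<mu>)"
      unfolding level by (subst nn_integral_cmult) (simp_all add: mult.left_commute)
    finally show "ennreal t * emeasure \<mu> {x \<in> space \<mu>. ennreal t < ball_maximal \<mu> F g x}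
        \<le> D * (\<integral>\<^sup>+x. 2 * g x * indicator {x. ennreal t < 2 * g x} x \<partial>\<mu>)"
      unfolding t_eq by (simp add: space_eq_UNIV)
  qed (use q in measurable)
  also have "\<dots> = strong_type_const q D * (\<integral>\<^sup>+x. enn_pow q (g x) \<partial>\<mu>)"
    by (simp add: enn_pow_mult nn_integral_cmult strong_type_const_def mult.assoc)
  finally show ?thesis .
qed

section \<open>From local balls to all balls\<close>

definition local_balls :: "real \<Rightarrow> 'a::metric_space \<Rightarrow> ('a \<times> real) set" where
  "local_balls \<kappa> a = {(c, r). 0 < r \<and> r < \<kappa> * dist c a}"

locale ball_growth =
  fixes \<phi> :: "'a::euclidean_space set \<Rightarrow> real" and D C \<eta> :: real
  assumes pos: "\<And>c r. 0 < r \<Longrightarrow> 0 < \<phi> (ball c r)"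
    and doubling: "\<And>c r. 0 < r \<Longrightarrow> \<phi> (ball c (2 * r)) \<le> D * \<phi> (ball c r)"
    and exponent_pos: "0 < \<eta>"
    and reverse_doubling: "\<And>c r b s. 0 < r \<Longrightarrow> 0 < s \<Longrightarrow> ball c r \<subseteq> ball b s \<Longrightarrow>
      \<phi> (ball c r) \<le> C * (r / s) powr \<eta> * \<phi> (ball b s)"

lemma measure_ball_divide:
  fixes b c :: "'a::euclidean_space"
  assumes "0 < r" "0 < s"
  shows "measure lebesgue (ball c r) / measure lebesgue (ball b s) = (r / s) powr DIM('a)"
  using assms
  by (simp add: content_ball powr_realpow power_divide
      unit_ball_vol_pos[THEN less_imp_neq, symmetric])

lemma phi_admissible_imp_ball_growth:
  fixes \<phi> :: "'a::euclidean_space set \<Rightarrow> real"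
  assumes "phi_admissible p \<phi> w"
  obtains D C \<eta> where "ball_growth \<phi> D C \<eta>"
proof -
  obtain D C \<delta> where pos: "\<And>c r. 0 < r \<Longrightarrow> 0 < \<phi> (ball c r)"
    and doubling: "\<And>c r. 0 < r \<Longrightarrow> \<phi> (ball c (2 * r)) \<le> D * \<phi> (ball c r)" and \<delta>: "0 < \<delta>"
    and reverse: "\<And>c r b s. 0 < r \<Longrightarrow> 0 < s \<Longrightarrow> ball c r \<subseteq> ball b s \<Longrightarrow> \<phi> (ball c r) / \<phi> (ball b s)
      \<le> C * (measure lebesgue (ball c r) / measure lebesgue (ball b s)) powr \<delta>"
    using assms unfolding phi_admissible_def by metis
  have "ball_growth \<phi> D C (DIM('a) * \<delta>)"
  proof
    fix c b :: 'a and r s :: real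
    assume r: "0 < r" and s: "0 < s" and sub: "ball c r \<subseteq> ball b s"
    have "\<phi> (ball c r) / \<phi> (ball b s) \<le> C * (r / s) powr (DIM('a) * \<delta>)"
      using reverse[OF r s sub] unfolding measure_ball_divide[OF r s] powr_powr .
    then show "\<phi> (ball c r) \<le> C * (r / s) powr (DIM('a) * \<delta>) * \<phi> (ball b s)"
      using pos[OF s, of b] by (simp add: pos_divide_le_eq)
  qed (use pos doubling \<delta> in auto)
  then show ?thesis by (rule that)
qed

lemma ex_dyadic_interval:
  assumes "0 < d" "d \<le> (1::real)"
  shows "\<exists>j. (1 / 2) ^ Suc j \<le> d \<and> d \<le> (1 / 2) ^ j"
proof -
  obtain n where "(1 / 2) ^ n < d" using real_arch_pow_inv[OF assms(1), of "1 / 2"] by auto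
  then have ex: "\<exists>n. (1 / 2) ^ Suc n \<le> d" using assms(1) by (intro exI[of _ n]) simp
  define j where "j = (LEAST j. (1 / 2) ^ Suc j \<le> d)"
  have "(1 / 2) ^ Suc j \<le> d" unfolding j_def by (rule LeastI_ex[OF ex])
  moreover have "d \<le> (1 / 2) ^ j"
  proof (cases j)
    case (Suc i)
    then have "i < j" by simp
    then have "\<not> (1 / 2) ^ Suc i \<le> d" unfolding j_def by (rule not_less_Least)
    then show ?thesis using Suc by simp
  qed (use assms in simp)
  ultimately show ?thesis by blast
qed

lemma ball_subset_dyadic_annuli:
  fixes a :: "'a::real_normed_vector"
  assumes cover: "cball 0 1 - ball 0 (1 / 2) \<subseteq> (\<Union>y\<in>Y. ball y \<epsilon>)" and R: "0 < R"
  shows "ball a R \<subseteq> {a} \<union> (\<Union>j. \<Union>y\<in>Y. ball (a + ((1 / 2) ^ j * R) *\<^sub>R y) ((1 / 2) ^ j * R * \<epsilon>))"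
proof
  fix x assume x: "x \<in> ball a R"
  show "x \<in> {a} \<union> (\<Union>j. \<Union>y\<in>Y. ball (a + ((1 / 2) ^ j * R) *\<^sub>R y) ((1 / 2) ^ j * R * \<epsilon>))"
  proof (cases "x = a")
    case False
    then have "0 < norm (x - a) / R" "norm (x - a) / R \<le> 1"
      using x R by (auto simp: dist_norm norm_minus_commute)
    then obtain j where j: "(1 / 2) ^ Suc j \<le> norm (x - a) / R" "norm (x - a) / R \<le> (1 / 2) ^ j"
      using ex_dyadic_interval by blast
    define s where "s = (1 / 2) ^ j * R"
    have s: "0 < s" using R by (simp add: s_def)
    define z where "z = (x - a) /\<^sub>R s"
    have x_eq: "x = a + s *\<^sub>R z" using s by (simp add: z_def)
    have "norm (x - a) = s * norm z" using s by (simp add: z_def)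
    moreover have "s * (1 / 2) \<le> norm (x - a)" "norm (x - a) \<le> s * 1"
      using j R by (auto simp: s_def field_simps)
    ultimately have "1 / 2 \<le> norm z" "norm z \<le> 1"
      using s by (simp_all only: mult_le_cancel_left_pos)
    then have "z \<in> cball 0 1 - ball 0 (1 / 2)" by simp
    then obtain y where y: "y \<in> Y" "dist y z < \<epsilon>" using cover by auto
    have "dist (a + s *\<^sub>R y) x = s * dist y z"
      unfolding x_eq using s by (simp add: dist_norm flip: scaleR_diff_right)
    also have "\<dots> < s * \<epsilon>" using y s by simp
    finally show ?thesis using y(1) by (auto simp: s_def)
  qed simp
qed

lemma emeasure_le_geometric_cover:
  assumes sub: "A \<subseteq> N \<union> (\<Union>j. \<Union>y\<in>Y. B j y)" and N: "N \<in> null_sets \<nu>" and Y: "finite Y"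
    and B: "\<And>j y. y \<in> Y \<Longrightarrow> B j y \<in> sets \<nu>"
    and le: "\<And>j y. y \<in> Y \<Longrightarrow> emeasure \<nu> (B j y) \<le> K * ennreal (\<theta> ^ j)"
    and \<theta>: "0 \<le> \<theta>" "\<theta> < 1"
  shows "emeasure \<nu> A \<le> ennreal (card Y / (1 - \<theta>)) * K"
proof -
  have UN: "(\<Union>y\<in>Y. B j y) \<in> sets \<nu>" for j using Y B by auto
  have "emeasure \<nu> A \<le> emeasure \<nu> ((\<Union>j. \<Union>y\<in>Y. B j y) \<union> N)"
    using UN N sub by (intro emeasure_mono sets.Un sets.countable_UN) auto
  also have "\<dots> = emeasure \<nu> (\<Union>j. \<Union>y\<in>Y. B j y)"
    using UN N by (intro emeasure_Un_null_set sets.countable_UN) auto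
  also have "\<dots> \<le> (\<Sum>j. emeasure \<nu> (\<Union>y\<in>Y. B j y))"
    using UN by (intro emeasure_subadditive_countably) auto
  also have "\<dots> \<le> (\<Sum>j. of_nat (card Y) * (K * ennreal (\<theta> ^ j)))"
  proof (intro suminf_le summableI)
    fix j
    have "emeasure \<nu> (\<Union>y\<in>Y. B j y) \<le> (\<Sum>y\<in>Y. emeasure \<nu> (B j y))"
      using Y B by (intro emeasure_subadditive_finite) auto
    also have "\<dots> \<le> of_nat (card Y) * (K * ennreal (\<theta> ^ j))"
      by (rule sum_bounded_above[OF le])
    finally show "emeasure \<nu> (\<Union>y\<in>Y. B j y) \<le> of_nat (card Y) * (K * ennreal (\<theta> ^ j))" .
  qed
  also have "\<dots> = of_nat (card Y) * K * (\<Sum>j. ennreal (\<theta> ^ j))"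
    by (simp add: ennreal_suminf_cmult mult.assoc)
  also have "(\<Sum>j. ennreal (\<theta> ^ j)) = ennreal (1 / (1 - \<theta>))"
    using \<theta> geometric_sums[of \<theta>] by (intro suminf_ennreal_eq) auto
  also have "of_nat (card Y) * K * ennreal (1 / (1 - \<theta>))
      = ennreal (card Y) * ennreal (1 / (1 - \<theta>)) * K"
    by (simp add: ac_simps ennreal_of_nat_eq_real_of_nat)
  also have "ennreal (card Y) * ennreal (1 / (1 - \<theta>)) = ennreal (card Y / (1 - \<theta>))"
    using \<theta> by (simp flip: ennreal_mult)
  finally show ?thesis .
qed

context ball_growth
begin

lemma constants_nonneg: "0 \<le> D" "0 \<le> C"
proof -
  have "0 < D * \<phi> (ball 0 1)" using pos[of 2 0] doubling[of 1 0] by simp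
  then show "0 \<le> D" using pos[of 1 0] by (simp add: zero_less_mult_iff)
  have "0 < C * \<phi> (ball 0 1)" using pos[of 1 0] reverse_doubling[of 1 1 0 0] by simp
  then show "0 \<le> C" using pos[of 1 0] by (simp add: zero_less_mult_iff)
qed

lemma doubling_iterate:
  assumes "0 < r"
  shows "\<phi> (ball c (2 ^ k * r)) \<le> D ^ k * \<phi> (ball c r)"
proof (induction k)
  case (Suc k)
  have "\<phi> (ball c (2 ^ Suc k * r)) \<le> D * \<phi> (ball c (2 ^ k * r))"
    using doubling[of "2 ^ k * r" c] assms by (simp add: mult.assoc)
  also have "\<dots> \<le> D * (D ^ k * \<phi> (ball c r))"
    by (rule mult_left_mono[OF Suc constants_nonneg(1)])
  finally show ?case by (simp add: mult.assoc)
qed simp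

lemma le_if_ball_subset_dilate:
  assumes r: "0 < r" and s: "0 < s" and sub: "ball b s \<subseteq> ball c (2 ^ k * r)"
  shows "\<phi> (ball b s) \<le> C * (s / (2 ^ k * r)) powr \<eta> * (D ^ k * \<phi> (ball c r))"
proof -
  have "\<phi> (ball b s) \<le> C * (s / (2 ^ k * r)) powr \<eta> * \<phi> (ball c (2 ^ k * r))"
    using r s sub by (intro reverse_doubling) auto
  also have "\<dots> \<le> C * (s / (2 ^ k * r)) powr \<eta> * (D ^ k * \<phi> (ball c r))"
    using constants_nonneg by (intro mult_left_mono doubling_iterate r) auto
  finally show ?thesis .
qed

lemma dyadic_ball_le:
  assumes R: "0 < R" and \<epsilon>: "0 < \<epsilon>" "\<epsilon> \<le> 1" and y: "norm y \<le> 1"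
  shows "\<phi> (ball (a + ((1 / 2) ^ j * R) *\<^sub>R y) ((1 / 2) ^ j * R * \<epsilon>))
    \<le> C * D * \<phi> (ball a R) * ((1 / 2) powr \<eta>) ^ j"
proof -
  define s where "s = (1 / 2) ^ j * R"
  have s: "0 < s" "s \<le> R" using R by (auto simp: s_def power_le_one)
  have s\<epsilon>: "0 < s * \<epsilon>" "s * \<epsilon> \<le> s" using s \<epsilon> by auto
  have "dist (a + s *\<^sub>R y) a \<le> s" using s y by (simp add: dist_norm mult_left_le)
  then have "ball (a + s *\<^sub>R y) (s * \<epsilon>) \<subseteq> ball a (2 ^ 1 * R)"
    using s s\<epsilon> by (simp add: ball_subset_ball_iff)
  from le_if_ball_subset_dilate[OF R s\<epsilon>(1) this]
  have "\<phi> (ball (a + s *\<^sub>R y) (s * \<epsilon>)) \<le> C * (s * \<epsilon> / (2 * R)) powr \<eta> * (D * \<phi> (ball a R))"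
    by simp
  also have "\<dots> \<le> C * ((1 / 2) powr \<eta>) ^ j * (D * \<phi> (ball a R))"
  proof (intro mult_right_mono mult_left_mono)
    have "(s * \<epsilon> / (2 * R)) powr \<eta> \<le> ((1 / 2) ^ j) powr \<eta>"
      using R \<epsilon> exponent_pos by (intro powr_mono2) (auto simp: s_def field_simps)
    also have "\<dots> = ((1 / 2) powr \<eta>) ^ j"
      by (simp add: powr_realpow[symmetric] powr_powr powr_power mult.commute)
    finally show "(s * \<epsilon> / (2 * R)) powr \<eta> \<le> ((1 / 2) powr \<eta>) ^ j" .
  qed (use constants_nonneg pos[OF R, of a] in auto)
  finally show ?thesis by (simp add: s_def ac_simps)
qed

lemma emeasure_centred_ball_le:
  fixes \<nu> :: "'a measure" and Y :: "'a set"
  assumes \<epsilon>: "0 < \<epsilon>" "\<epsilon> \<le> 1"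
    and Y: "finite Y" "Y \<subseteq> cball 0 1 - ball 0 (1 / 2)"
    and cover: "cball 0 1 - ball 0 (1 / 2) \<subseteq> (\<Union>y\<in>Y. ball y (\<epsilon> / 4))"
    and sets: "sets \<nu> = sets lebesgue" and null: "emeasure \<nu> {a} = 0"
    and le: "\<And>c r. (c, r) \<in> local_balls \<epsilon> a \<Longrightarrow> emeasure \<nu> (ball c r) \<le> K * ennreal (\<phi> (ball c r))"
    and R: "0 < R"
  shows "emeasure \<nu> (ball a R)
    \<le> ennreal (card Y / (1 - (1 / 2) powr \<eta>)) * (K * ennreal (C * D * \<phi> (ball a R)))"
proof (rule emeasure_le_geometric_cover)
  show "ball a R \<subseteq> {a} \<union> (\<Union>j. \<Union>y\<in>Y. ball (a + ((1 / 2) ^ j * R) *\<^sub>R y) ((1 / 2) ^ j * R * (\<epsilon> / 4)))"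
    by (rule ball_subset_dyadic_annuli[OF cover R])
  show "{a} \<in> null_sets \<nu>" by (simp add: null_sets_def null sets)
  show "ball (a + ((1 / 2) ^ j * R) *\<^sub>R y) ((1 / 2) ^ j * R * (\<epsilon> / 4)) \<in> sets \<nu>" for j y
    unfolding sets by simp
  show "(1 / 2) powr \<eta> < 1" using powr_less_mono2[OF exponent_pos, of "1 / 2" 1] by simp
  show "emeasure \<nu> (ball (a + ((1 / 2) ^ j * R) *\<^sub>R y) ((1 / 2) ^ j * R * (\<epsilon> / 4)))
      \<le> K * ennreal (C * D * \<phi> (ball a R)) * ennreal (((1 / 2) powr \<eta>) ^ j)" if "y \<in> Y" for j y
  proof -
    let ?s = "(1 / 2) ^ j * R"
    let ?B = "ball (a + ?s *\<^sub>R y) (?s * (\<epsilon> / 4))"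
    have s: "0 < ?s" using R by simp
    have y: "1 / 2 \<le> norm y" "norm y \<le> 1" using that Y(2) by auto
    have "?s * (\<epsilon> / 4) < \<epsilon> * (?s * (1 / 2))" using R \<epsilon> by simp
    also have "\<dots> \<le> \<epsilon> * (?s * norm y)" using s y \<epsilon> by (intro mult_left_mono) auto
    also have "?s * norm y = dist (a + ?s *\<^sub>R y) a" using s by (simp add: dist_norm)
    finally have "(a + ?s *\<^sub>R y, ?s * (\<epsilon> / 4)) \<in> local_balls \<epsilon> a"
      using R \<epsilon> by (simp add: local_balls_def)
    then have "emeasure \<nu> ?B \<le> K * ennreal (\<phi> ?B)" by (rule le)
    also have "\<dots> \<le> K * ennreal (C * D * \<phi> (ball a R) * ((1 / 2) powr \<eta>) ^ j)"
      using \<epsilon> y R by (intro mult_left_mono ennreal_leI dyadic_ball_le) auto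
    also have "\<dots> = K * ennreal (C * D * \<phi> (ball a R)) * ennreal (((1 / 2) powr \<eta>) ^ j)"
      using constants_nonneg pos[OF R, of a] by (simp add: ennreal_mult mult.assoc)
    finally show ?thesis .
  qed
qed (use Y in auto)

lemma nonlocal_ball_subset_centred_ball:
  assumes \<epsilon>: "0 < \<epsilon>" and k: "1 + 2 / \<epsilon> < 2 ^ k" and r: "0 < r"
    and nonlocal: "(c, r) \<notin> local_balls \<epsilon> a"
  obtains R where "0 < R" "ball c r \<subseteq> ball a R" "\<phi> (ball a R) \<le> C * D ^ k * \<phi> (ball c r)"
proof -
  define R where "R = dist c a + r"
  have dist: "2 * dist c a \<le> r * 2 / \<epsilon>"
    using nonlocal r \<epsilon> by (simp add: local_balls_def field_simps)
  have R: "0 < R" using r by (simp add: R_def add_nonneg_pos)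
  have sub: "ball c r \<subseteq> ball a R" by (simp add: R_def ball_subset_ball_iff)
  have le: "R + dist a c \<le> 2 ^ k * r"
    using dist mult_left_mono[OF less_imp_le[OF k], of r] r
    by (simp add: R_def dist_commute field_simps)
  then have "ball a R \<subseteq> ball c (2 ^ k * r)" by (simp add: ball_subset_ball_iff add.commute)
  from le_if_ball_subset_dilate[OF r R this]
  have "\<phi> (ball a R) \<le> C * (R / (2 ^ k * r)) powr \<eta> * (D ^ k * \<phi> (ball c r))" .
  also have "\<dots> \<le> C * 1 * (D ^ k * \<phi> (ball c r))"
  proof (intro mult_right_mono mult_left_mono)
    have "R \<le> 2 ^ k * r" using le zero_le_dist[of a c] by linarith
    then show "(R / (2 ^ k * r)) powr \<eta> \<le> 1"
      using R r exponent_pos by (intro powr_le1) auto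
  qed (use constants_nonneg pos[OF r, of c] in auto)
  finally show ?thesis using R sub by (intro that[of R]) (simp_all add: mult.assoc)
qed

lemma emeasure_nonlocal_ball_le:
  assumes \<epsilon>: "0 < \<epsilon>" and k: "1 + 2 / \<epsilon> < 2 ^ k" and r: "0 < r"
    and nonlocal: "(c, r) \<notin> local_balls \<epsilon> a"
    and sets: "sets \<nu> = sets lebesgue" and m: "0 \<le> m"
    and centred: "\<And>R. 0 < R \<Longrightarrow>
        emeasure \<nu> (ball a R) \<le> ennreal m * (K * ennreal (C * D * \<phi> (ball a R)))"
  shows "emeasure \<nu> (ball c r) \<le> ennreal (m * (C * D) * (C * D ^ k)) * (K * ennreal (\<phi> (ball c r)))"
proof -
  obtain R where R: "0 < R" and sub: "ball c r \<subseteq> ball a R"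
    and \<phi>: "\<phi> (ball a R) \<le> C * D ^ k * \<phi> (ball c r)"
    by (rule nonlocal_ball_subset_centred_ball[OF \<epsilon> k r nonlocal])
  have "emeasure \<nu> (ball c r) \<le> emeasure \<nu> (ball a R)"
    by (rule emeasure_mono[OF sub]) (simp add: sets)
  also have "\<dots> \<le> ennreal m * (K * ennreal (C * D * \<phi> (ball a R)))"
    by (rule centred[OF R])
  also have "\<dots> \<le> ennreal m * (K * ennreal (C * D * (C * D ^ k * \<phi> (ball c r))))"
    using constants_nonneg \<phi> by (intro mult_left_mono ennreal_leI) auto
  also have "\<dots> = ennreal (m * (C * D) * (C * D ^ k)) * (K * ennreal (\<phi> (ball c r)))"
    using m constants_nonneg pos[OF r, of c] by (simp add: ennreal_mult ac_simps)
  finally show ?thesis .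
qed

lemma local_bound_imp_global_bound:
  assumes \<epsilon>: "0 < \<epsilon>" "\<epsilon> \<le> 1"
  obtains L :: real where "\<And>(\<nu> :: 'a measure) K a c r. sets \<nu> = sets lebesgue \<Longrightarrow> emeasure \<nu> {a} = 0 \<Longrightarrow>
      (\<And>c r. (c, r) \<in> local_balls \<epsilon> a \<Longrightarrow> emeasure \<nu> (ball c r) \<le> K * ennreal (\<phi> (ball c r))) \<Longrightarrow>
      0 < r \<Longrightarrow> emeasure \<nu> (ball c r) \<le> ennreal L * (K * ennreal (\<phi> (ball c r)))"
proof -
  have "compact (cball 0 1 - ball 0 (1 / 2) :: 'a set)" by (intro compact_diff) auto
  then obtain Y :: "'a set" where Y: "finite Y" "Y \<subseteq> cball 0 1 - ball 0 (1 / 2)"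
      "cball 0 1 - ball 0 (1 / 2) \<subseteq> (\<Union>y\<in>Y. ball y (\<epsilon> / 4))"
    using seq_compact_imp_totally_bounded[OF compact_imp_seq_compact] \<epsilon>(1)
    by (metis zero_less_divide_iff zero_less_numeral)
  obtain k where k: "1 + 2 / \<epsilon> < 2 ^ k" using real_arch_pow[of 2 "1 + 2 / \<epsilon>"] by auto
  define m where "m = card Y / (1 - (1 / 2) powr \<eta>)"
  have m: "0 \<le> m" using powr_less_mono2[OF exponent_pos, of "1 / 2" 1] by (simp add: m_def)
  define L where "L = m * (C * D) * (C * D ^ k)"
  show ?thesis
  proof (rule that[of "max 1 L"])
    fix \<nu> :: "'a measure" and K :: ennreal and a c :: 'a and r :: real
    assume sets: "sets \<nu> = sets lebesgue" and null: "emeasure \<nu> {a} = 0"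
      and le: "\<And>c r. (c, r) \<in> local_balls \<epsilon> a \<Longrightarrow> emeasure \<nu> (ball c r) \<le> K * ennreal (\<phi> (ball c r))"
      and r: "0 < r"
    have centred: "emeasure \<nu> (ball a R) \<le> ennreal m * (K * ennreal (C * D * \<phi> (ball a R)))"
      if "0 < R" for R
      unfolding m_def by (rule emeasure_centred_ball_le[OF \<epsilon> Y sets null le that])
    have "emeasure \<nu> (ball c r) \<le> ennreal 1 * (K * ennreal (\<phi> (ball c r)))
        \<or> emeasure \<nu> (ball c r) \<le> ennreal L * (K * ennreal (\<phi> (ball c r)))"
    proof (cases "(c, r) \<in> local_balls \<epsilon> a")
      case False
      then show ?thesis
        unfolding L_def by (intro disjI2 emeasure_nonlocal_ball_le[OF \<epsilon>(1) k r _ sets m centred])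
    qed (simp add: le)
    moreover have "ennreal 1 * (K * ennreal (\<phi> (ball c r)))
        \<le> ennreal (max 1 L) * (K * ennreal (\<phi> (ball c r)))"
      "ennreal L * (K * ennreal (\<phi> (ball c r))) \<le> ennreal (max 1 L) * (K * ennreal (\<phi> (ball c r)))"
      by (intro mult_right_mono ennreal_leI; simp)+
    ultimately show "emeasure \<nu> (ball c r) \<le> ennreal (max 1 L) * (K * ennreal (\<phi> (ball c r)))"
      by (meson order_trans)
  qed
qed

end

section \<open>Weighted measures\<close>

lemma sets_lebesgue_ball [measurable]: "ball c r \<in> sets lebesgue"
  by simp

lemma emeasure_lebesgue_ball_nonzero: "0 < r \<Longrightarrow> emeasure lebesgue (ball c r) \<noteq> 0"
  using content_ball_gt_0_iff[of c r] by (auto simp: measure_def)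

lemma emeasure_lebesgue_ball_less_top: "emeasure lebesgue (ball c r) < top"
  using emeasure_lborel_ball_finite[of c r] by simp

lemma emeasure_lebesgue_ball_dilate:
  fixes c :: "'a::euclidean_space"
  assumes "0 < r" "0 < k"
  shows "emeasure lebesgue (ball c (k * r)) = ennreal (k ^ DIM('a)) * emeasure lebesgue (ball c r)"
  using assms by (simp add: emeasure_ball power_mult_distrib mult.left_commute flip: ennreal_mult)

lemma sigma_finite_lebesgue: "sigma_finite_measure (lebesgue :: 'a::euclidean_space measure)"
proof
  have "(\<Union>n::nat. ball (0::'a) (real n)) = space lebesgue" using reals_Archimedean2 by auto
  then show "\<exists>A. countable A \<and> A \<subseteq> sets (lebesgue :: 'a measure) \<and> \<Union> A = space lebesgue \<and>
      (\<forall>a\<in>A. emeasure lebesgue a \<noteq> \<infinity>)"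
    by (intro exI[of _ "range (\<lambda>n::nat. ball (0::'a) (real n))"]) (auto simp: emeasure_ball)
qed

abbreviation weight_measure :: "('a::euclidean_space \<Rightarrow> real) \<Rightarrow> 'a measure" where
  "weight_measure w \<equiv> density lebesgue (\<lambda>x. ennreal (w x))"

lemma sigma_finite_weight_measure:
  "w \<in> borel_measurable lebesgue \<Longrightarrow> sigma_finite_measure (weight_measure w)"
  by (subst sigma_finite_measure.sigma_finite_iff_density_finite[OF sigma_finite_lebesgue]) auto

lemma emeasure_weight_measure:
  "w \<in> borel_measurable lebesgue \<Longrightarrow> B \<in> sets lebesgue \<Longrightarrow> emeasure (weight_measure w) B = wmeas w B"
  by (simp add: wmeas_def emeasure_density)

lemma set_nn_integral_weight_measure:
  assumes [measurable]: "w \<in> borel_measurable lebesgue" "h \<in> borel_measurable lebesgue"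
      "B \<in> sets lebesgue"
  shows "(\<integral>\<^sup>+x\<in>B. h x \<partial>weight_measure w) = (\<integral>\<^sup>+x\<in>B. h x * ennreal (w x) \<partial>lebesgue)"
  by (subst nn_integral_density) (auto intro!: nn_integral_cong simp: ac_simps)

lemma weightD:
  assumes "weight w"
  shows "0 \<le> w x" "w \<in> borel_measurable lebesgue"
  using assms by (auto simp: weight_def)

lemma weight_emeasure_ball_less_top:
  assumes w: "weight w"
  shows "emeasure (weight_measure w) (ball c r) < top"
proof -
  have [measurable]: "w \<in> borel_measurable lebesgue"
    and int: "set_integrable lebesgue (cball c r) w"
    using w by (auto simp: weight_def)
  have "emeasure (weight_measure w) (ball c r) \<le> emeasure (weight_measure w) (cball c r)"
    by (intro emeasure_mono) auto
  also have "\<dots> = (\<integral>\<^sup>+x. ennreal (norm (indicator (cball c r) x *\<^sub>R w x)) \<partial>lebesgue)"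
    using weightD(1)[OF w]
    by (subst emeasure_density) (auto intro!: nn_integral_cong simp: indicator_def)
  also have "\<dots> < top"
    using int unfolding set_integrable_def integrable_iff_bounded by simp
  finally show ?thesis .
qed

lemma null_sets_weight_measure_singleton:
  assumes [measurable]: "w \<in> borel_measurable lebesgue"
  shows "{a} \<in> null_sets (weight_measure w)"
proof -
  have "AE x in lebesgue. x \<noteq> a" by (rule AE_I'[of "{a}"]) (auto simp: null_sets_def)
  then have "AE x in lebesgue. x \<in> {a} \<longrightarrow> ennreal (w x) = 0" by (rule eventually_mono) simp
  then show ?thesis by (intro null_sets_density_iff[THEN iffD2] conjI) auto
qed

lemma AE_all_balls_charged:
  fixes \<mu> :: "'a::euclidean_space measure"
  assumes sets: "sets \<mu> = sets lebesgue"
  shows "AE x in \<mu>. \<forall>c r. x \<in> ball c r \<longrightarrow> emeasure \<mu> (ball c r) \<noteq> 0"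
proof -
  define \<F> where "\<F> = {B. \<exists>c r. B = ball c r \<and> emeasure \<mu> B = 0}"
  obtain \<F>' where \<F>': "\<F>' \<subseteq> \<F>" "countable \<F>'" "\<Union>\<F>' = \<Union>\<F>"
    by (rule Lindelof[of \<F>]) (auto simp: \<F>_def)
  have "\<Union>\<F>' \<in> null_sets \<mu>"
    using \<F>'
    by (intro null_sets_UN'[of \<F>' "\<lambda>x. x", simplified]) (auto simp: \<F>_def null_sets_def sets)
  then show ?thesis
    unfolding \<F>'(3) by (rule AE_I') (auto simp: \<F>_def simp del: mem_ball)
qed

lemma weight_mult_enn_pow_divide:
  assumes "0 \<le> u"
  shows "ennreal u * enn_pow q (k / ennreal u) = ennreal (u powr (1 - q)) * enn_pow q k"
proof (cases "u = 0")
  case False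
  then have u: "0 < u" using assms by simp
  have "ennreal u * enn_pow q (k / ennreal u) = ennreal (u * (1 / u) powr q) * enn_pow q k"
    using u by (simp add: ennreal_divide_ennreal enn_pow_mult enn_pow_ennreal ennreal_mult ac_simps)
  also have "u * (1 / u) powr q = u powr (1 - q)"
    using u by (simp add: powr_divide powr_diff)
  finally show ?thesis .
qed simp

lemma nn_integral_enn_pow_divide_weight:
  assumes [measurable]: "u \<in> borel_measurable lebesgue" "k \<in> borel_measurable lebesgue"
    and "\<And>x. 0 \<le> u x"
  shows "(\<integral>\<^sup>+x. enn_pow q (k x / ennreal (u x)) \<partial>weight_measure u)
    = (\<integral>\<^sup>+x. enn_pow q (k x) \<partial>weight_measure (\<lambda>x. u x powr (1 - q)))"
  using assms(3) by (simp add: nn_integral_density weight_mult_enn_pow_divide)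

lemma set_nn_integral_divide_weight:
  assumes [measurable]: "u \<in> borel_measurable lebesgue" "k \<in> borel_measurable lebesgue"
      "B \<in> sets lebesgue"
    and pos: "AE x in lebesgue. x \<in> B \<longrightarrow> 0 < u x"
  shows "(\<integral>\<^sup>+x\<in>B. k x / ennreal (u x) \<partial>weight_measure u) = (\<integral>\<^sup>+x\<in>B. k x \<partial>lebesgue)"
proof -
  have "(\<integral>\<^sup>+x\<in>B. k x / ennreal (u x) \<partial>weight_measure u)
      = (\<integral>\<^sup>+x\<in>B. k x / ennreal (u x) * ennreal (u x) \<partial>lebesgue)"
    by (rule set_nn_integral_weight_measure) measurable
  also have "\<dots> = (\<integral>\<^sup>+x\<in>B. k x \<partial>lebesgue)"
    using pos by (intro nn_integral_cong_AE) (auto simp: ennreal_divide_mult_cancel indicator_def)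
  finally show ?thesis .
qed

section \<open>Muckenhoupt conditions\<close>

definition dual_weight :: "real \<Rightarrow> ('a \<Rightarrow> real) \<Rightarrow> 'a \<Rightarrow> real" where
  "dual_weight p w x = w x powr (1 - p / (p - 1))"

definition extended_dual_weight :: "real \<Rightarrow> ('a \<Rightarrow> real) \<Rightarrow> 'a \<Rightarrow> ennreal" where
  "extended_dual_weight p w x = (if w x = 0 then \<infinity> else ennreal (dual_weight p w x))"

definition muckenhoupt :: "real \<Rightarrow> real \<Rightarrow> ('a::euclidean_space \<Rightarrow> real) \<Rightarrow> 'a set \<Rightarrow> bool" where
  "muckenhoupt p C w B \<longleftrightarrow>
    enn_pow (1 / p) (wmeas w B) * enn_pow (1 - 1 / p) (\<integral>\<^sup>+x\<in>B. extended_dual_weight p w x \<partial>lebesgue)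
      \<le> ennreal C * emeasure lebesgue B"

definition muckenhoupt_1 :: "real \<Rightarrow> ('a::euclidean_space \<Rightarrow> real) \<Rightarrow> 'a set \<Rightarrow> bool" where
  "muckenhoupt_1 C w B \<longleftrightarrow>
    (AE x in lebesgue. x \<in> B \<longrightarrow> wmeas w B \<le> ennreal C * emeasure lebesgue B * ennreal (w x))"

lemma borel_measurable_dual_weight [measurable]:
  "w \<in> borel_measurable lebesgue \<Longrightarrow> dual_weight p w \<in> borel_measurable lebesgue"
  unfolding dual_weight_def by measurable

lemma borel_measurable_extended_dual_weight [measurable]:
  assumes "w \<in> borel_measurable lebesgue"
  shows "extended_dual_weight p w \<in> borel_measurable lebesgue"
proof -
  have "{x \<in> space lebesgue. w x = 0} \<in> sets lebesgue"
    using measurable_sets[OF assms, of "{0}"] by (simp add: vimage_def)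
  then show ?thesis
    unfolding extended_dual_weight_def using assms by (intro measurable_If) auto
qed

lemma dual_weight_nonneg: "0 \<le> dual_weight p w x"
  by (simp add: dual_weight_def)

lemma dual_weight_powr:
  assumes "1 < p" "0 \<le> w x"
  shows "dual_weight p w x powr (1 - p) = w x"
proof -
  have "(1 - p / (p - 1)) * (1 - p) = 1" using assms by (simp add: field_simps)
  then show ?thesis using assms by (simp add: dual_weight_def powr_powr)
qed

subsection \<open>Translation\<close>

lemma distr_lebesgue_translation:
  "distr lebesgue lebesgue (\<lambda>x. x + a) = (lebesgue :: 'a::euclidean_space measure)"
  and measurable_lebesgue_translation: "(\<lambda>x. x + a) \<in> (lebesgue :: 'a measure) \<rightarrow>\<^sub>M lebesgue"
proof -
  have affine: "(\<lambda>x::'a. a + (\<Sum>j\<in>Basis. (1 * (x \<bullet> j)) *\<^sub>R j)) = (\<lambda>x. x + a)"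
    by (simp add: euclidean_representation add.commute)
  show "distr lebesgue lebesgue (\<lambda>x. x + a) = (lebesgue :: 'a measure)"
    using lebesgue_affine_euclidean[of "\<lambda>_. 1" a] unfolding affine by (simp add: density_1)
  show "(\<lambda>x. x + a) \<in> (lebesgue :: 'a measure) \<rightarrow>\<^sub>M lebesgue"
    using lebesgue_affine_measurable[of "\<lambda>_. 1" a] unfolding affine by simp
qed

lemma mem_ball_translation: "x \<in> ball (c - a) r \<longleftrightarrow> x + a \<in> ball c r"
  for a c x :: "'a::real_normed_vector"
  by (simp add: dist_norm algebra_simps)

lemma set_nn_integral_ball_translation:
  fixes a :: "'a::euclidean_space"
  assumes [measurable]: "f \<in> borel_measurable lebesgue"
  shows "(\<integral>\<^sup>+x\<in>ball (c - a) r. f (x + a) \<partial>lebesgue) = (\<integral>\<^sup>+x\<in>ball c r. f x \<partial>lebesgue)"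
proof -
  have "(\<integral>\<^sup>+x\<in>ball c r. f x \<partial>distr lebesgue lebesgue (\<lambda>x. x + a))
      = (\<integral>\<^sup>+x. f (x + a) * indicator (ball c r) (x + a) \<partial>lebesgue)"
    by (rule nn_integral_distr[OF measurable_lebesgue_translation]) measurable
  also have "\<dots> = (\<integral>\<^sup>+x\<in>ball (c - a) r. f (x + a) \<partial>lebesgue)"
    by (intro nn_integral_cong) (simp add: indicator_def mem_ball_translation del: mem_ball)
  finally show ?thesis by (simp add: distr_lebesgue_translation)
qed

lemma wmeas_ball_translation:
  assumes "w \<in> borel_measurable lebesgue"
  shows "wmeas (\<lambda>x. w (x + a)) (ball (c - a) r) = wmeas w (ball c r)"
  unfolding wmeas_def using assms by (subst set_nn_integral_ball_translation[symmetric]) auto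

lemma emeasure_lebesgue_ball_translation:
  fixes c :: "'a::euclidean_space"
  shows "emeasure lebesgue (ball (c - a) r) = emeasure lebesgue (ball c r)"
  by (cases "0 \<le> r") (simp_all add: emeasure_ball ball_empty)

lemma A_p_loc_translation:
  assumes w: "w \<in> borel_measurable lebesgue" and "A_p_loc \<kappa> p (\<lambda>x. w (x + a))"
  obtains C where "\<And>c r. (c, r) \<in> local_balls \<kappa> a \<Longrightarrow> muckenhoupt p C w (ball c r)"
proof -
  obtain C where C: "\<And>c r. 0 < r \<Longrightarrow> r < \<kappa> * norm c \<Longrightarrow> muckenhoupt p C (\<lambda>x. w (x + a)) (ball c r)"
    using assms(2) unfolding A_p_loc_def muckenhoupt_def extended_dual_weight_def dual_weight_def
    by blast
  have dual: "extended_dual_weight p (\<lambda>x. w (x + a)) = (\<lambda>x. extended_dual_weight p w (x + a))"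
    by (simp add: extended_dual_weight_def dual_weight_def fun_eq_iff)
  have "muckenhoupt p C w (ball c r)" if "(c, r) \<in> local_balls \<kappa> a" for c r
    using C[of r "c - a"] that borel_measurable_extended_dual_weight[OF w, of p]
    unfolding muckenhoupt_def dual
    by (simp only: wmeas_ball_translation[OF w] set_nn_integral_ball_translation
        emeasure_lebesgue_ball_translation local_balls_def dist_norm mem_Collect_eq prod.case)
  then show ?thesis by (rule that)
qed

lemma A_1_loc_translation:
  fixes w :: "'a::euclidean_space \<Rightarrow> real"
  assumes w[measurable]: "w \<in> borel_measurable lebesgue" and "A_1_loc \<kappa> (\<lambda>x. w (x + a))"
  obtains C where "\<And>c r. (c, r) \<in> local_balls \<kappa> a \<Longrightarrow> muckenhoupt_1 C w (ball c r)"
proof -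
  obtain C where C: "\<And>c r. 0 < r \<Longrightarrow> r < \<kappa> * norm c \<Longrightarrow> muckenhoupt_1 C (\<lambda>x. w (x + a)) (ball c r)"
    using assms(2) unfolding A_1_loc_def muckenhoupt_1_def by blast
  have "muckenhoupt_1 C w (ball c r)" if "(c, r) \<in> local_balls \<kappa> a" for c r
  proof -
    let ?P = "\<lambda>x. x \<in> ball c r \<longrightarrow>
        wmeas w (ball c r) \<le> ennreal C * emeasure lebesgue (ball c r) * ennreal (w x)"
    have "{x \<in> space lebesgue. ?P x} \<in> sets lebesgue" by measurable
    moreover have "AE x in lebesgue. ?P (x + a)"
      using C[of r "c - a"] that
      unfolding muckenhoupt_1_def mem_ball_translation wmeas_ball_translation[OF w]
        emeasure_lebesgue_ball_translation
      by (simp add: local_balls_def dist_norm del: mem_ball)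
    ultimately have "AE x in distr lebesgue lebesgue (\<lambda>x. x + a). ?P x"
      by (subst AE_distr_iff[OF measurable_lebesgue_translation])
    then show ?thesis unfolding muckenhoupt_1_def distr_lebesgue_translation .
  qed
  then show ?thesis by (rule that)
qed

subsection \<open>The condition for exponents greater than one\<close>

locale muckenhoupt_set =
  fixes p C :: real and w :: "'a::euclidean_space \<Rightarrow> real" and B :: "'a set"
  assumes p: "1 < p"
    and nonneg: "\<And>x. 0 \<le> w x" and borel_w [measurable]: "w \<in> borel_measurable lebesgue"
    and sets_B [measurable]: "B \<in> sets lebesgue"
    and volume: "emeasure lebesgue B \<noteq> 0" "emeasure lebesgue B < top"
    and charged: "emeasure (weight_measure w) B \<noteq> 0" "emeasure (weight_measure w) B < top"
    and muckenhoupt: "muckenhoupt p C w B"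
begin

abbreviation "\<mu> \<equiv> weight_measure w"
abbreviation "\<sigma> \<equiv> weight_measure (dual_weight p w)"

lemma emeasure_mult_extended_dual_le:
  "emeasure \<mu> B * enn_pow (p - 1) (\<integral>\<^sup>+x\<in>B. extended_dual_weight p w x \<partial>lebesgue)
    \<le> enn_pow p (ennreal C * emeasure lebesgue B)"
proof -
  let ?T = "\<integral>\<^sup>+x\<in>B. extended_dual_weight p w x \<partial>lebesgue"
  have "enn_pow p (enn_pow (1 / p) (wmeas w B) * enn_pow (1 - 1 / p) ?T)
      \<le> enn_pow p (ennreal C * emeasure lebesgue B)"
    using p muckenhoupt unfolding muckenhoupt_def by (intro enn_pow_mono) auto
  then show ?thesis
    using p by (simp add: enn_pow_mult enn_pow_enn_pow right_diff_distrib emeasure_weight_measure)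
qed

lemma extended_dual_finite: "(\<integral>\<^sup>+x\<in>B. extended_dual_weight p w x \<partial>lebesgue) < top"
proof -
  have "enn_pow p (ennreal C * emeasure lebesgue B) < top"
    using volume by (simp add: ennreal_mult_less_top)
  with emeasure_mult_extended_dual_le
  have "emeasure \<mu> B * enn_pow (p - 1) (\<integral>\<^sup>+x\<in>B. extended_dual_weight p w x \<partial>lebesgue) < top"
    by (rule le_less_trans)
  then show ?thesis using charged(1) by (auto simp: ennreal_mult_less_top)
qed

lemma AE_weight_pos: "AE x in lebesgue. x \<in> B \<longrightarrow> 0 < w x"
proof -
  have "AE x in lebesgue. extended_dual_weight p w x * indicator B x \<noteq> \<infinity>"
    using extended_dual_finite by (intro nn_integral_PInf_AE) auto
  then show ?thesis
  proof (rule eventually_mono, intro impI)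
    fix x assume "extended_dual_weight p w x * indicator B x \<noteq> \<infinity>" "x \<in> B"
    then have "w x \<noteq> 0" by (auto simp: extended_dual_weight_def)
    then show "0 < w x" using nonneg[of x] by simp
  qed
qed

lemma dual_emeasure_le: "emeasure \<sigma> B \<le> (\<integral>\<^sup>+x\<in>B. extended_dual_weight p w x \<partial>lebesgue)"
  by (subst emeasure_density)
    (auto intro!: nn_integral_mono simp: indicator_def extended_dual_weight_def)

lemma dual_emeasure_less_top: "emeasure \<sigma> B < top"
  using dual_emeasure_le extended_dual_finite by (rule le_less_trans)

lemma dual_emeasure_nonzero: "emeasure \<sigma> B \<noteq> 0"
proof
  assume "emeasure \<sigma> B = 0"
  then have "AE x in lebesgue. ennreal (dual_weight p w x) * indicator B x = 0"
    by (subst (asm) emeasure_density) (auto simp: nn_integral_0_iff_AE)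
  with AE_weight_pos have "AE x in lebesgue. x \<notin> B"
    by eventually_elim (auto simp: indicator_def dual_weight_def)
  then have "emeasure lebesgue B = 0" by (subst (asm) AE_iff_measurable[of B]) auto
  then show False using volume(1) by simp
qed

lemma emeasure_mult_dual_le:
  "emeasure \<mu> B * enn_pow (p - 1) (emeasure \<sigma> B) \<le> enn_pow p (ennreal C * emeasure lebesgue B)"
proof -
  have "emeasure \<mu> B * enn_pow (p - 1) (emeasure \<sigma> B)
      \<le> emeasure \<mu> B * enn_pow (p - 1) (\<integral>\<^sup>+x\<in>B. extended_dual_weight p w x \<partial>lebesgue)"
    using p by (intro mult_left_mono enn_pow_mono dual_emeasure_le) auto
  also note emeasure_mult_extended_dual_le
  finally show ?thesis .
qed

lemma volume_le_emeasure_mult_dual: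
  "enn_pow p (emeasure lebesgue B) \<le> emeasure \<mu> B * enn_pow (p - 1) (emeasure \<sigma> B)"
proof -
  let ?u = "\<lambda>x. ennreal (w x) * indicator B x"
    and ?v = "\<lambda>x. ennreal (dual_weight p w x) * indicator B x"
  have "emeasure lebesgue B = (\<integral>\<^sup>+x. indicator B x \<partial>lebesgue)" by simp
  also have "\<dots> = (\<integral>\<^sup>+x. enn_pow (1 / p) (?u x) * enn_pow (1 - 1 / p) (?v x) \<partial>lebesgue)"
  proof (rule nn_integral_cong_AE, use AE_weight_pos in eventually_elim)
    fix x assume pos: "x \<in> B \<longrightarrow> 0 < w x"
    have "1 / p + (1 - p / (p - 1)) * (1 - 1 / p) = 0" using p by (simp add: field_simps)
    then have "w x powr (1 / p) * dual_weight p w x powr (1 - 1 / p) = 1" if "x \<in> B"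
      using pos that by (simp add: dual_weight_def powr_powr flip: powr_add)
    then show "indicator B x = enn_pow (1 / p) (?u x) * enn_pow (1 - 1 / p) (?v x)"
      using nonneg[of x] dual_weight_nonneg[of p w x]
      by (auto simp: indicator_def enn_pow_ennreal simp flip: ennreal_mult)
  qed
  also have "\<dots> \<le> enn_pow (1 / p) (\<integral>\<^sup>+x. ?u x \<partial>lebesgue) * enn_pow (1 - 1 / p) (\<integral>\<^sup>+x. ?v x \<partial>lebesgue)"
    using p by (intro nn_integral_Holder) auto
  also have "\<dots> = enn_pow (1 / p) (emeasure \<mu> B) * enn_pow (1 - 1 / p) (emeasure \<sigma> B)"
    by (simp add: emeasure_density)
  finally have "enn_pow p (emeasure lebesgue B)
      \<le> enn_pow p (enn_pow (1 / p) (emeasure \<mu> B) * enn_pow (1 - 1 / p) (emeasure \<sigma> B))"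
    using p by (intro enn_pow_mono) auto
  then show ?thesis using p by (simp add: enn_pow_mult enn_pow_enn_pow right_diff_distrib)
qed

lemma set_nn_integral_eq_average_mult_dual:
  assumes [measurable]: "f \<in> borel_measurable lebesgue"
  shows "(\<integral>\<^sup>+x\<in>B. f x \<partial>lebesgue) = average \<sigma> B
    (\<lambda>x. f x / ennreal (dual_weight p w x)) * emeasure \<sigma> B"
proof -
  have "AE x in lebesgue. x \<in> B \<longrightarrow> 0 < dual_weight p w x"
    using AE_weight_pos by eventually_elim (auto simp: dual_weight_def)
  then show ?thesis
    unfolding average_mult_emeasure[OF dual_emeasure_nonzero dual_emeasure_less_top]
    by (subst set_nn_integral_divide_weight) auto
qed

end

lemma muckenhoupt_set_comparison:
  fixes w :: "'a::euclidean_space \<Rightarrow> real"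
  assumes "muckenhoupt_set p C w B" and "muckenhoupt_set p C w B'" and sub: "B \<subseteq> B'"
    and volume: "emeasure lebesgue B' \<le> k * emeasure lebesgue B"
  shows "emeasure (weight_measure w) B' \<le> enn_pow p (ennreal C * k) * emeasure (weight_measure w) B"
    and "emeasure (weight_measure (dual_weight p w)) B' \<le>
      enn_pow (1 / (p - 1)) (enn_pow p (ennreal C * k)) *
        emeasure (weight_measure (dual_weight p w)) B"
proof -
  interpret B: muckenhoupt_set p C w B by fact
  interpret B': muckenhoupt_set p C w B' by fact
  have p: "1 < p" by (rule B.p)
  let ?W = "weight_measure w" and ?S = "weight_measure (dual_weight p w)"
  let ?D = "enn_pow p (ennreal C * k)" and ?q = "\<lambda>E. enn_pow (p - 1) (emeasure ?S E)"
  have mono: "emeasure ?W B \<le> emeasure ?W B'" "emeasure ?S B \<le> emeasure ?S B'"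
    using sub B'.sets_B by (auto intro!: emeasure_mono)
  have "emeasure ?W B' * ?q B' \<le> enn_pow p (ennreal C * emeasure lebesgue B')"
    by (rule B'.emeasure_mult_dual_le)
  also have "\<dots> \<le> enn_pow p (ennreal C * k * emeasure lebesgue B)"
    using p volume by (intro enn_pow_mono) (auto simp: mult.assoc intro: mult_left_mono)
  also have "\<dots> = ?D * enn_pow p (emeasure lebesgue B)" by (rule enn_pow_mult)
  also have "\<dots> \<le> ?D * (emeasure ?W B * ?q B)"
    by (rule mult_left_mono[OF B.volume_le_emeasure_mult_dual]) simp
  finally have product: "emeasure ?W B' * ?q B' \<le> ?D * (emeasure ?W B * ?q B)" .
  have "?q B * emeasure ?W B' \<le> ?q B' * emeasure ?W B'"
    using p by (intro mult_right_mono enn_pow_mono mono) auto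
  also have "\<dots> \<le> ?q B * (?D * emeasure ?W B)" using product by (simp add: ac_simps)
  finally show "emeasure ?W B' \<le> ?D * emeasure ?W B"
    by (rule ennreal_mult_left_le_imp_le)
      (simp_all add: B.dual_emeasure_nonzero B.dual_emeasure_less_top)
  have "emeasure ?W B * ?q B' \<le> emeasure ?W B' * ?q B'"
    by (intro mult_right_mono mono) auto
  also have "\<dots> \<le> emeasure ?W B * (?D * ?q B)" using product by (simp add: ac_simps)
  finally have "?q B' \<le> ?D * ?q B"
    by (rule ennreal_mult_left_le_imp_le) (fact B.charged)+
  then have "enn_pow (1 / (p - 1)) (?q B') \<le> enn_pow (1 / (p - 1)) (?D * ?q B)"
    using p by (intro enn_pow_mono) auto
  then show "emeasure ?S B' \<le> enn_pow (1 / (p - 1)) ?D * emeasure ?S B"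
    using p by (simp add: enn_pow_mult)
qed

definition A_p_doubling_const :: "real \<Rightarrow> real \<Rightarrow> nat \<Rightarrow> ennreal" where
  "A_p_doubling_const p C n = enn_pow p (ennreal C * ennreal (5 ^ n))"

definition A_p_maximal_const :: "real \<Rightarrow> real \<Rightarrow> nat \<Rightarrow> ennreal" where
  "A_p_maximal_const p C n = enn_pow (p / (p - 1)) (enn_pow p (ennreal C)) *
    (strong_type_const (p / (p - 1)) (A_p_doubling_const p C n) *
     strong_type_const p (enn_pow (1 / (p - 1)) (A_p_doubling_const p C n)))"

lemma A_p_maximal_const_less_top: "A_p_maximal_const p C n < top"
  by (simp add: A_p_maximal_const_def strong_type_const_def A_p_doubling_const_def
      ennreal_mult_less_top)

locale charged_family =
  fixes w :: "'a::euclidean_space \<Rightarrow> real" and F :: "('a \<times> real) set" and R :: real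
  assumes w: "weight w"
    and radius: "\<And>c r. (c, r) \<in> F \<Longrightarrow> 0 < r \<and> r \<le> R"
    and charged: "\<And>c r. (c, r) \<in> F \<Longrightarrow> emeasure (weight_measure w) (ball c r) \<noteq> 0"
begin

abbreviation "\<mu> \<equiv> weight_measure w"

lemma borel_w [measurable]: "w \<in> borel_measurable lebesgue"
  by (rule weightD(2)[OF w])

end

locale muckenhoupt_family = charged_family w F R
  for w :: "'a::euclidean_space \<Rightarrow> real" and F R +
  fixes p C :: real
  assumes p: "1 < p"
    and A_p: "\<And>c r. (c, r) \<in> F \<Longrightarrow> muckenhoupt p C w (ball c r)"
    and A_p_dilate: "\<And>c r. (c, r) \<in> F \<Longrightarrow> muckenhoupt p C w (ball c (5 * r))"
begin

abbreviation "\<sigma> \<equiv> weight_measure (dual_weight p w)"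

lemma muckenhoupt_set_ball:
  assumes F: "(c, r) \<in> F"
  shows "muckenhoupt_set p C w (ball c r)" "muckenhoupt_set p C w (ball c (5 * r))"
proof -
  have r: "0 < r" using radius[OF F] by simp
  have "emeasure \<mu> (ball c r) \<le> emeasure \<mu> (ball c (5 * r))"
    using r by (intro emeasure_mono subset_ball) auto
  then have "emeasure \<mu> (ball c (5 * r)) \<noteq> 0" using charged[OF F] by auto
  then show "muckenhoupt_set p C w (ball c r)" "muckenhoupt_set p C w (ball c (5 * r))"
    using p r weightD[OF w] weight_emeasure_ball_less_top[OF w] charged[OF F] A_p[OF F]
      A_p_dilate[OF F]
    by (auto intro!: muckenhoupt_set.intro emeasure_lebesgue_ball_nonzero
        emeasure_lebesgue_ball_less_top simp del: emeasure_completion)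
qed

lemma muckenhoupt_doubling:
  assumes F: "(c, r) \<in> F"
  shows "emeasure \<mu> (ball c (5 * r))
      \<le> A_p_doubling_const p C DIM('a) * emeasure \<mu> (ball c r)"
    and "emeasure \<sigma> (ball c (5 * r))
      \<le> enn_pow (1 / (p - 1)) (A_p_doubling_const p C DIM('a)) * emeasure \<sigma> (ball c r)"
proof -
  have r: "0 < r" using radius[OF F] by simp
  then have "ball c r \<subseteq> ball c (5 * r)" by (intro subset_ball) simp
  moreover have "emeasure lebesgue (ball c (5 * r))
      \<le> ennreal (5 ^ DIM('a)) * emeasure lebesgue (ball c r)"
    using r by (subst emeasure_lebesgue_ball_dilate) auto
  ultimately show "emeasure \<mu> (ball c (5 * r))
      \<le> A_p_doubling_const p C DIM('a) * emeasure \<mu> (ball c r)"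
    and "emeasure \<sigma> (ball c (5 * r))
      \<le> enn_pow (1 / (p - 1)) (A_p_doubling_const p C DIM('a)) * emeasure \<sigma> (ball c r)"
    unfolding A_p_doubling_const_def
    using muckenhoupt_set_comparison[OF muckenhoupt_set_ball[OF F]] by blast+
qed

sublocale W: doubling_family \<mu> F R "A_p_doubling_const p C DIM('a)"
  by unfold_locales (use radius muckenhoupt_doubling(1) in auto)

sublocale S: doubling_family \<sigma> F R "enn_pow (1 / (p - 1)) (A_p_doubling_const p C DIM('a))"
  by unfold_locales (use radius muckenhoupt_doubling(2) in auto)

definition dual_maximal :: "('a \<Rightarrow> ennreal) \<Rightarrow> 'a \<Rightarrow> ennreal" where
  "dual_maximal f = ball_maximal \<sigma> F (\<lambda>x. f x / ennreal (dual_weight p w x))"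

lemma borel_measurable_dual_maximal [measurable]: "dual_maximal f \<in> borel_measurable lebesgue"
  unfolding dual_maximal_def by measurable

text \<open>Lerner's argument: averages of \<open>f\<close> are dominated by iterating the maximal operators with
  respect to the dual weight and to \<open>w\<close>.\<close>

lemma enn_pow_average_le:
  assumes F: "(c, r) \<in> F" and f[measurable]: "f \<in> borel_measurable lebesgue"
  shows "enn_pow (p - 1) (average lebesgue (ball c r) f) \<le> enn_pow p (ennreal C) *
    average \<mu> (ball c r) (\<lambda>x. enn_pow (p - 1) (dual_maximal f x) / ennreal (w x))"
proof -
  let ?B = "ball c r"
  interpret B: muckenhoupt_set p C w ?B by (rule muckenhoupt_set_ball(1)[OF F])
  define V where "V = emeasure lebesgue ?B"
  define H where "H = (\<integral>\<^sup>+y\<in>?B. enn_pow (p - 1) (dual_maximal f y) \<partial>lebesgue)"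
  define J where "J = average \<sigma> ?B (\<lambda>x. f x / ennreal (dual_weight p w x))"
  have V: "V \<noteq> 0" "V < top" using B.volume by (simp_all add: V_def)
  have average_eq: "average lebesgue ?B f * V = J * emeasure \<sigma> ?B"
    unfolding V_def J_def average_mult_emeasure[OF B.volume]
    by (rule B.set_nn_integral_eq_average_mult_dual[OF f])
  have "enn_pow (p - 1) J * V = (\<integral>\<^sup>+y\<in>?B. enn_pow (p - 1) J \<partial>lebesgue)"
    unfolding V_def by (subst nn_integral_cmult_indicator) auto
  also have "\<dots> \<le> H"
    unfolding H_def J_def dual_maximal_def using p
    by (intro nn_integral_mono)
      (auto simp: indicator_def intro!: enn_pow_mono average_le_ball_maximal[OF F])
  finally have J_le: "enn_pow (p - 1) J * V \<le> H" .
  have "(enn_pow (p - 1) V * V) * (emeasure \<mu> ?B * enn_pow (p - 1) (average lebesgue ?B f))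
      = emeasure \<mu> ?B * enn_pow (p - 1) (average lebesgue ?B f * V) * V"
    by (simp add: enn_pow_mult ac_simps)
  also have "\<dots> = (emeasure \<mu> ?B * enn_pow (p - 1) (emeasure \<sigma> ?B)) * (enn_pow (p - 1) J * V)"
    unfolding average_eq by (simp add: enn_pow_mult ac_simps)
  also have "\<dots> \<le> enn_pow p (ennreal C * V) * H"
    unfolding V_def by (intro mult_mono B.emeasure_mult_dual_le J_le[unfolded V_def]) auto
  also have "\<dots> = (enn_pow (p - 1) V * V) * (enn_pow p (ennreal C) * H)"
    using p enn_pow_add[of "p - 1" 1 V] by (simp add: enn_pow_mult ac_simps)
  finally have "emeasure \<mu> ?B * enn_pow (p - 1) (average lebesgue ?B f) \<le> enn_pow p (ennreal C) * H"
    by (rule ennreal_mult_left_le_imp_le) (simp_all add: V ennreal_mult_less_top)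
  then have "enn_pow (p - 1) (average lebesgue ?B f) \<le> enn_pow p (ennreal C) * (H / emeasure \<mu> ?B)"
    using B.charged by (simp add: ennreal_le_divide_iff ennreal_times_divide mult.commute)
  also have "H = (\<integral>\<^sup>+x\<in>?B. enn_pow (p - 1) (dual_maximal f x) / ennreal (w x) \<partial>\<mu>)"
    unfolding H_def using B.AE_weight_pos by (intro set_nn_integral_divide_weight[symmetric]) auto
  finally show ?thesis by (simp only: average_def)
qed

lemma ball_maximal_le_iterated:
  assumes f: "f \<in> borel_measurable lebesgue"
  shows "ball_maximal lebesgue F f x \<le> enn_pow (1 / (p - 1)) (enn_pow p (ennreal C) *
    ball_maximal \<mu> F (\<lambda>x. enn_pow (p - 1) (dual_maximal f x) / ennreal (w x)) x)"
    (is "_ \<le> enn_pow _ (_ * ?M)")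
  unfolding ball_maximal_le_iff
proof (intro allI impI)
  fix c r assume cr: "(c, r) \<in> F \<and> x \<in> ball c r"
  then have "enn_pow (p - 1) (average lebesgue (ball c r) f) \<le> enn_pow p (ennreal C) *
      average \<mu> (ball c r) (\<lambda>x. enn_pow (p - 1) (dual_maximal f x) / ennreal (w x))"
    using f by (intro enn_pow_average_le) auto
  also have "\<dots> \<le> enn_pow p (ennreal C) * ?M"
    using cr by (intro mult_left_mono average_le_ball_maximal) auto
  finally have "enn_pow (1 / (p - 1)) (enn_pow (p - 1) (average lebesgue (ball c r) f))
      \<le> enn_pow (1 / (p - 1)) (enn_pow p (ennreal C) * ?M)"
    using p by (intro enn_pow_mono) auto
  then show "average lebesgue (ball c r) f \<le> enn_pow (1 / (p - 1)) (enn_pow p (ennreal C) * ?M)"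
    using p by simp
qed

lemma ball_maximal_strong_type:
  assumes f[measurable]: "f \<in> borel_measurable lebesgue"
  shows "(\<integral>\<^sup>+x. enn_pow p (ball_maximal lebesgue F f x) \<partial>\<mu>)
    \<le> A_p_maximal_const p C DIM('a) * (\<integral>\<^sup>+x. enn_pow p (f x) \<partial>\<mu>)"
proof -
  define p' where "p' = p / (p - 1)"
  have p': "1 < p'" "(p - 1) * p' = p" "p' * (p - 1) = p" "p * (1 / (p - 1)) = p'"
    using p by (auto simp: p'_def field_simps)
  let ?D = "A_p_doubling_const p C DIM('a)"
  let ?h = "\<lambda>x. enn_pow (p - 1) (dual_maximal f x) / ennreal (w x)"
  let ?c = "enn_pow p' (enn_pow p (ennreal C))"
  let ?c\<^sub>W = "strong_type_const p' ?D" and ?c\<^sub>S = "strong_type_const p (enn_pow (1 / (p - 1)) ?D)"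
  have "enn_pow p (ball_maximal lebesgue F f x) \<le> ?c * enn_pow p' (ball_maximal \<mu> F ?h x)" for x
    using enn_pow_mono[OF _ ball_maximal_le_iterated[OF f, of x], of p] p
    unfolding enn_pow_enn_pow[of p "1 / (p - 1)"] p'(4) by (simp add: enn_pow_mult)
  then have "(\<integral>\<^sup>+x. enn_pow p (ball_maximal lebesgue F f x) \<partial>\<mu>)
      \<le> (\<integral>\<^sup>+x. ?c * enn_pow p' (ball_maximal \<mu> F ?h x) \<partial>\<mu>)"
    by (intro nn_integral_mono)
  also have "\<dots> = ?c * (\<integral>\<^sup>+x. enn_pow p' (ball_maximal \<mu> F ?h x) \<partial>\<mu>)"
    by (intro nn_integral_cmult) measurable
  also have "\<dots> \<le> ?c * (?c\<^sub>W * (\<integral>\<^sup>+x. enn_pow p' (?h x) \<partial>\<mu>))"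
    by (intro mult_left_mono W.strong_type sigma_finite_weight_measure p') measurable
  also have "(\<integral>\<^sup>+x. enn_pow p' (?h x) \<partial>\<mu>) = (\<integral>\<^sup>+x. enn_pow p (dual_maximal f x) \<partial>\<sigma>)"
    using weightD(1)[OF w] p'(3)
    by (subst nn_integral_enn_pow_divide_weight) (auto simp: enn_pow_enn_pow p'_def dual_weight_def)
  also have "?c * (?c\<^sub>W * \<dots>)
      \<le> ?c * (?c\<^sub>W * (?c\<^sub>S * (\<integral>\<^sup>+x. enn_pow p (f x / ennreal (dual_weight p w x)) \<partial>\<sigma>)))"
    unfolding dual_maximal_def
    by (intro mult_left_mono S.strong_type sigma_finite_weight_measure p) measurable
  also have "(\<integral>\<^sup>+x. enn_pow p (f x / ennreal (dual_weight p w x)) \<partial>\<sigma>) = (\<integral>\<^sup>+x. enn_pow p (f x) \<partial>\<mu>)"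
    using p weightD(1)[OF w]
    by (subst nn_integral_enn_pow_divide_weight) (auto simp: dual_weight_nonneg dual_weight_powr)
  finally show ?thesis by (simp add: A_p_maximal_const_def p'_def mult.assoc)
qed

end

subsection \<open>The condition for exponent one\<close>

lemma muckenhoupt_1_mult_integral_le:
  fixes w :: "'a::euclidean_space \<Rightarrow> real"
  assumes [measurable]: "w \<in> borel_measurable lebesgue" "f \<in> borel_measurable lebesgue"
      "B \<in> sets lebesgue" "B' \<in> sets lebesgue"
    and sub: "B \<subseteq> B'" and A_1: "muckenhoupt_1 C w B'"
  shows "emeasure (weight_measure w) B' * (\<integral>\<^sup>+x\<in>B. f x \<partial>lebesgue)
    \<le> ennreal C * emeasure lebesgue B' * (\<integral>\<^sup>+x\<in>B. f x \<partial>weight_measure w)"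
proof -
  have "emeasure (weight_measure w) B' * (\<integral>\<^sup>+x\<in>B. f x \<partial>lebesgue)
      = (\<integral>\<^sup>+x. wmeas w B' * (f x * indicator B x) \<partial>lebesgue)"
    by (simp add: nn_integral_cmult emeasure_weight_measure)
  also have "\<dots>
      \<le> (\<integral>\<^sup>+x. ennreal C * emeasure lebesgue B' * (f x * ennreal (w x) * indicator B x) \<partial>lebesgue)"
  proof (rule nn_integral_mono_AE, use A_1[unfolded muckenhoupt_1_def] in eventually_elim)
    fix x assume le: "x \<in> B' \<longrightarrow> wmeas w B' \<le> ennreal C * emeasure lebesgue B' * ennreal (w x)"
    show "wmeas w B' * (f x * indicator B x)
        \<le> ennreal C * emeasure lebesgue B' * (f x * ennreal (w x) * indicator B x)"
    proof (cases "x \<in> B")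
      case True
      then have "wmeas w B' * f x \<le> ennreal C * emeasure lebesgue B' * ennreal (w x) * f x"
        using le sub by (intro mult_right_mono) auto
      then show ?thesis using True by (simp add: ac_simps)
    qed simp
  qed
  also have "\<dots> = ennreal C * emeasure lebesgue B' * (\<integral>\<^sup>+x\<in>B. f x \<partial>weight_measure w)"
    by (simp add: nn_integral_cmult set_nn_integral_weight_measure)
  finally show ?thesis .
qed

locale muckenhoupt_1_family = charged_family w F R
  for w :: "'a::euclidean_space \<Rightarrow> real" and F R +
  fixes C :: real
  assumes A_1: "\<And>c r. (c, r) \<in> F \<Longrightarrow> muckenhoupt_1 C w (ball c r)"
    and A_1_dilate: "\<And>c r. (c, r) \<in> F \<Longrightarrow> muckenhoupt_1 C w (ball c (5 * r))"
begin

lemma muckenhoupt_1_doubling: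
  assumes F: "(c, r) \<in> F"
  shows "emeasure \<mu> (ball c (5 * r)) \<le> ennreal C * ennreal (5 ^ DIM('a)) * emeasure \<mu> (ball c r)"
proof -
  have r: "0 < r" using radius[OF F] by simp
  have "emeasure \<mu> (ball c (5 * r)) * (\<integral>\<^sup>+x\<in>ball c r. 1 \<partial>lebesgue)
      \<le> ennreal C * emeasure lebesgue (ball c (5 * r)) * (\<integral>\<^sup>+x\<in>ball c r. 1 \<partial>\<mu>)"
    using r A_1_dilate[OF F] by (intro muckenhoupt_1_mult_integral_le subset_ball) auto
  also have "emeasure lebesgue (ball c (5 * r))
      = ennreal (5 ^ DIM('a)) * emeasure lebesgue (ball c r)"
    using r by (rule emeasure_lebesgue_ball_dilate) simp
  finally have "emeasure lebesgue (ball c r) * emeasure \<mu> (ball c (5 * r))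
      \<le> emeasure lebesgue (ball c r)
        * (ennreal C * ennreal (5 ^ DIM('a)) * emeasure \<mu> (ball c r))"
    by (simp add: ac_simps del: emeasure_completion)
  then show ?thesis
    by (rule ennreal_mult_left_le_imp_le)
      (rule emeasure_lebesgue_ball_nonzero[OF r] emeasure_lebesgue_ball_less_top)+
qed

sublocale W: doubling_family \<mu> F R "ennreal C * ennreal (5 ^ DIM('a))"
  by unfold_locales (use radius muckenhoupt_1_doubling in auto)

lemma average_le_weighted_average:
  assumes F: "(c, r) \<in> F" and f[measurable]: "f \<in> borel_measurable lebesgue"
  shows "average lebesgue (ball c r) f \<le> average \<mu> (ball c r) (\<lambda>x. ennreal C * f x)"
proof -
  let ?B = "ball c r"
  have volume: "emeasure lebesgue ?B \<noteq> 0" "emeasure lebesgue ?B < top"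
    using radius[OF F] emeasure_lebesgue_ball_nonzero emeasure_lebesgue_ball_less_top by blast+
  have mass: "emeasure \<mu> ?B \<noteq> 0" "emeasure \<mu> ?B < top"
    by (rule charged[OF F], rule weight_emeasure_ball_less_top[OF w])
  have "emeasure \<mu> ?B * (\<integral>\<^sup>+x\<in>?B. f x \<partial>lebesgue)
      \<le> ennreal C * emeasure lebesgue ?B * (\<integral>\<^sup>+x\<in>?B. f x \<partial>\<mu>)"
    by (intro muckenhoupt_1_mult_integral_le A_1[OF F]) auto
  then have "emeasure lebesgue ?B * (average lebesgue ?B f * emeasure \<mu> ?B)
      \<le> emeasure lebesgue ?B * (ennreal C * (\<integral>\<^sup>+x\<in>?B. f x \<partial>\<mu>))"
    unfolding average_mult_emeasure[OF volume, symmetric] by (simp only: ac_simps)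
  then have "average lebesgue ?B f * emeasure \<mu> ?B \<le> ennreal C * (\<integral>\<^sup>+x\<in>?B. f x \<partial>\<mu>)"
    by (rule ennreal_mult_left_le_imp_le[OF _ volume])
  also have "\<dots> = (\<integral>\<^sup>+x\<in>?B. ennreal C * f x \<partial>\<mu>)"
    by (simp add: nn_integral_cmult mult.assoc)
  finally show ?thesis
    unfolding average_def[of \<mu>] ennreal_le_divide_iff[OF mass] .
qed

lemma ball_maximal_weak_type:
  assumes f[measurable]: "f \<in> borel_measurable lebesgue"
  shows "t * emeasure \<mu> {x. t < ball_maximal lebesgue F f x}
    \<le> ennreal C * ennreal (5 ^ DIM('a)) * ennreal C * (\<integral>\<^sup>+x. f x \<partial>\<mu>)"
proof -
  let ?g = "\<lambda>x. ennreal C * f x"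
  have "ball_maximal lebesgue F f x \<le> ball_maximal \<mu> F ?g x" for x
    unfolding ball_maximal_le_iff
    using average_le_weighted_average[OF _ f] average_le_ball_maximal by (meson order_trans)
  then have "emeasure \<mu> {x. t < ball_maximal lebesgue F f x}
      \<le> emeasure \<mu> {x. t < ball_maximal \<mu> F ?g x}"
    by (intro emeasure_mono) (auto intro: less_le_trans)
  then have "t * emeasure \<mu> {x. t < ball_maximal lebesgue F f x}
      \<le> t * emeasure \<mu> {x. t < ball_maximal \<mu> F ?g x}"
    by (rule mult_left_mono) simp
  also have "\<dots> \<le> ennreal C * ennreal (5 ^ DIM('a)) * (\<integral>\<^sup>+x. ?g x \<partial>\<mu>)"
    by (rule W.weak_type) measurable
  finally show ?thesis by (simp add: nn_integral_cmult mult.assoc)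
qed

end

section \<open>Morrey norms\<close>

locale weighted_morrey =
  fixes p :: real and \<phi> :: "'a::euclidean_space set \<Rightarrow> real" and w :: "'a \<Rightarrow> real"
  assumes p: "0 < p" and phi_pos: "\<And>c r. 0 < r \<Longrightarrow> 0 < \<phi> (ball c r)"
    and borel_w [measurable]: "w \<in> borel_measurable lebesgue"
begin

abbreviation "\<mu> \<equiv> weight_measure w"
abbreviation "abs_norm f \<equiv> morrey_norm p \<phi> w (\<lambda>x. ennreal \<bar>f x\<bar>)"
abbreviation "ball_norm c r \<equiv> morrey_norm p \<phi> w (indicator (ball c r))"

lemma morrey_norm_le_iff:
  assumes [measurable]: "g \<in> borel_measurable lebesgue"
  shows "morrey_norm p \<phi> w g \<le> N \<longleftrightarrow> (\<forall>c r. 0 < r \<longrightarrow>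
    (\<integral>\<^sup>+x\<in>ball c r. enn_pow p (g x) \<partial>\<mu>) \<le> ennreal (\<phi> (ball c r)) * enn_pow p N)"
  unfolding morrey_norm_def SUP_le_iff using p phi_pos
  by (auto simp: enn_pow_root_le_iff ennreal_one_divide_mult_le_iff set_nn_integral_weight_measure)

lemma weak_morrey_norm_le_iff:
  assumes g[measurable]: "g \<in> borel_measurable lebesgue"
  shows "weak_morrey_norm p \<phi> w g \<le> N \<longleftrightarrow> (\<forall>c r t. 0 < r \<and> 0 < t \<longrightarrow>
    (\<integral>\<^sup>+x\<in>ball c r. enn_pow p (ennreal t) * indicator {ennreal t<..} (g x) \<partial>\<mu>)
      \<le> ennreal (\<phi> (ball c r)) * enn_pow p N)"
proof -
  have "ennreal t *
      enn_pow (1 / p) (wmeas w {x \<in> ball c r. g x > ennreal t} * ennreal (1 / \<phi> (ball c r))) \<le> N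
    \<longleftrightarrow> (\<integral>\<^sup>+x\<in>ball c r. enn_pow p (ennreal t) * indicator {ennreal t<..} (g x) \<partial>\<mu>)
      \<le> ennreal (\<phi> (ball c r)) * enn_pow p N" if "0 < r" for c r t
  proof -
    have "{x \<in> ball c r. g x > ennreal t} = ball c r \<inter> {x \<in> space lebesgue. ennreal t < g x}"
      by auto
    also have "\<dots> \<in> sets lebesgue" by measurable
    finally have level: "{x \<in> ball c r. g x > ennreal t} \<in> sets lebesgue" .
    have "ennreal t *
        enn_pow (1 / p) (wmeas w {x \<in> ball c r. g x > ennreal t} * ennreal (1 / \<phi> (ball c r)))
        = enn_pow (1 / p) (ennreal (1 / \<phi> (ball c r)) *
          (enn_pow p (ennreal t) * wmeas w {x \<in> ball c r. g x > ennreal t}))"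
      using p by (simp add: enn_pow_mult mult_ac)
    also have "enn_pow p (ennreal t) * wmeas w {x \<in> ball c r. g x > ennreal t}
        = (\<integral>\<^sup>+x. enn_pow p (ennreal t) * indicator {x \<in> ball c r. g x > ennreal t} x \<partial>\<mu>)"
      using level by (simp add: nn_integral_cmult_indicator emeasure_weight_measure)
    also have "\<dots> = (\<integral>\<^sup>+x\<in>ball c r. enn_pow p (ennreal t) * indicator {ennreal t<..} (g x) \<partial>\<mu>)"
      by (intro nn_integral_cong) (auto simp: indicator_def)
    finally show ?thesis
      using p phi_pos[OF that] by (simp add: enn_pow_root_le_iff ennreal_one_divide_mult_le_iff)
  qed
  then show ?thesis unfolding weak_morrey_norm_def SUP_le_iff by auto
qed

definition hl_max_gauge_bound :: "real \<Rightarrow> (ennreal \<Rightarrow> ennreal) \<Rightarrow> bool" where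
  "hl_max_gauge_bound L \<Phi> \<longleftrightarrow> (\<forall>f c r. f \<in> borel_measurable lebesgue \<longrightarrow>
    abs_norm f < \<infinity> \<longrightarrow> 0 < r \<longrightarrow>
    (\<integral>\<^sup>+x\<in>ball c r. \<Phi> (hl_max f x) \<partial>\<mu>)
      \<le> ennreal (\<phi> (ball c r)) * enn_pow p (ennreal L * abs_norm f))"

lemma M_bdd_if_gauge_bound: "hl_max_gauge_bound L (enn_pow p) \<Longrightarrow> M_bdd p \<phi> w"
  unfolding hl_max_gauge_bound_def M_bdd_def by (auto simp: morrey_norm_le_iff)

lemma M_bdd_weak_if_gauge_bound:
  assumes "\<And>t. 0 < t \<Longrightarrow>
      hl_max_gauge_bound L (\<lambda>y. enn_pow p (ennreal t) * indicator {ennreal t<..} y)"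
  shows "M_bdd_weak p \<phi> w"
  using assms unfolding hl_max_gauge_bound_def M_bdd_weak_def
  by (intro exI[of _ L]) (auto simp: weak_morrey_norm_le_iff)

lemma set_nn_integral_le_morrey_norm:
  assumes "g \<in> borel_measurable lebesgue" "0 < r"
  shows "(\<integral>\<^sup>+x\<in>ball c r. enn_pow p (g x) \<partial>\<mu>)
    \<le> ennreal (\<phi> (ball c r)) * enn_pow p (morrey_norm p \<phi> w g)"
  using morrey_norm_le_iff[OF assms(1), of "morrey_norm p \<phi> w g"] assms(2) by auto

lemma emeasure_ball_le_morrey_norm_indicator:
  assumes "0 < r"
  shows "emeasure \<mu> (ball c r) \<le> ennreal (\<phi> (ball c r)) * enn_pow p (ball_norm c r)"
proof -
  have "emeasure \<mu> (ball c r) = (\<integral>\<^sup>+x\<in>ball c r. enn_pow p (indicator (ball c r) x) \<partial>\<mu>)"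
    by (simp flip: indicator_inter_arith)
  also have "\<dots> \<le> ennreal (\<phi> (ball c r)) * enn_pow p (ball_norm c r)"
    using assms by (intro set_nn_integral_le_morrey_norm) measurable
  finally show ?thesis .
qed

lemma morrey_norm_mono:
  assumes "\<And>x. f x \<le> g x"
  shows "morrey_norm p \<phi> w f \<le> morrey_norm p \<phi> w g"
  unfolding morrey_norm_def using p assms
  by (intro SUP_mono') (auto intro!: enn_pow_mono mult_left_mono nn_integral_mono mult_right_mono)

lemma morrey_norm_cmult:
  assumes [measurable]: "g \<in> borel_measurable lebesgue"
  shows "morrey_norm p \<phi> w (\<lambda>x. k * g x) = k * morrey_norm p \<phi> w g"
  unfolding morrey_norm_def SUP_mult_left_ennreal
proof (intro SUP_cong refl, clarify)
  fix c :: 'a and r :: real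
  have "(\<integral>\<^sup>+x\<in>ball c r. enn_pow p (k * g x) * ennreal (w x) \<partial>lebesgue)
      = (\<integral>\<^sup>+x. enn_pow p k * (enn_pow p (g x) * ennreal (w x) * indicator (ball c r) x) \<partial>lebesgue)"
    by (simp add: enn_pow_mult mult.assoc)
  also have "\<dots> = enn_pow p k * (\<integral>\<^sup>+x\<in>ball c r. enn_pow p (g x) * ennreal (w x) \<partial>lebesgue)"
    by (rule nn_integral_cmult) measurable
  finally show "enn_pow (1 / p) (ennreal (1 / \<phi> (ball c r)) *
        (\<integral>\<^sup>+x\<in>ball c r. enn_pow p (k * g x) * ennreal (w x) \<partial>lebesgue))
      = k * enn_pow (1 / p) (ennreal (1 / \<phi> (ball c r)) *
        (\<integral>\<^sup>+x\<in>ball c r. enn_pow p (g x) * ennreal (w x) \<partial>lebesgue))"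
    using p by (simp add: enn_pow_mult mult.left_commute)
qed

lemma mult_morrey_norm_indicator_le_weak_morrey_norm:
  assumes [measurable]: "g \<in> borel_measurable lebesgue" "E \<in> sets lebesgue"
    and t: "0 < t" and less: "\<And>x. x \<in> E \<Longrightarrow> ennreal t < g x"
  shows "ennreal t * morrey_norm p \<phi> w (indicator E) \<le> weak_morrey_norm p \<phi> w g"
proof -
  have "morrey_norm p \<phi> w (\<lambda>x. ennreal t * indicator E x) \<le> weak_morrey_norm p \<phi> w g"
  proof (subst morrey_norm_le_iff, measurable, intro allI impI)
    fix c r assume r: "0 < (r::real)"
    have "(\<integral>\<^sup>+x\<in>ball c r. enn_pow p (ennreal t * indicator E x) \<partial>\<mu>)
        \<le> (\<integral>\<^sup>+x\<in>ball c r. enn_pow p (ennreal t) * indicator {ennreal t<..} (g x) \<partial>\<mu>)"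
      using less by (intro nn_integral_mono) (auto simp: indicator_def)
    also have "\<dots> \<le> ennreal (\<phi> (ball c r)) * enn_pow p (weak_morrey_norm p \<phi> w g)"
      using weak_morrey_norm_le_iff[of g "weak_morrey_norm p \<phi> w g"] r t by auto
    finally show "(\<integral>\<^sup>+x\<in>ball c r. enn_pow p (ennreal t * indicator E x) \<partial>\<mu>)
        \<le> ennreal (\<phi> (ball c r)) * enn_pow p (weak_morrey_norm p \<phi> w g)" .
  qed
  then show ?thesis by (simp add: morrey_norm_cmult)
qed

lemma nn_integral_le_mult_kothe_norm:
  assumes f[measurable]: "f \<in> borel_measurable lebesgue"
    and g[measurable]: "g \<in> borel_measurable lebesgue"
    and l: "0 < l" and le: "abs_norm f \<le> ennreal l"
  shows "(\<integral>\<^sup>+x. ennreal \<bar>f x * g x\<bar> \<partial>lebesgue) \<le> ennreal l * kothe_norm (morrey_norm p \<phi> w) g"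
proof -
  have inverse: "ennreal (1 / l) * ennreal l = 1" using l by (simp flip: ennreal_mult)
  have "morrey_norm p \<phi> w (\<lambda>x. ennreal \<bar>f x / l\<bar>)
      = morrey_norm p \<phi> w (\<lambda>x. ennreal (1 / l) * ennreal \<bar>f x\<bar>)"
    using l by (simp flip: ennreal_mult)
  also have "\<dots> = ennreal (1 / l) * abs_norm f"
    by (rule morrey_norm_cmult) measurable
  also have "\<dots> \<le> ennreal (1 / l) * ennreal l" by (rule mult_left_mono[OF le]) simp
  finally have "(\<integral>\<^sup>+x. ennreal \<bar>f x / l * g x\<bar> \<partial>lebesgue) \<le> kothe_norm (morrey_norm p \<phi> w) g"
    unfolding kothe_norm_def inverse by (intro SUP_upper2[of "\<lambda>x. f x / l"]) auto
  then have "ennreal l * (\<integral>\<^sup>+x. ennreal \<bar>f x / l * g x\<bar> \<partial>lebesgue)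
      \<le> ennreal l * kothe_norm (morrey_norm p \<phi> w) g"
    by (rule mult_left_mono) simp
  also have "ennreal l * (\<integral>\<^sup>+x. ennreal \<bar>f x / l * g x\<bar> \<partial>lebesgue)
      = (\<integral>\<^sup>+x. ennreal l * ennreal \<bar>f x / l * g x\<bar> \<partial>lebesgue)"
    by (rule nn_integral_cmult[symmetric]) measurable
  also have "\<dots> = (\<integral>\<^sup>+x. ennreal \<bar>f x * g x\<bar> \<partial>lebesgue)"
    using l by (intro nn_integral_cong) (simp add: abs_mult flip: ennreal_mult)
  finally show ?thesis .
qed

lemma morrey_norm_indicator_mult_average_le:
  assumes [measurable]: "f \<in> borel_measurable lebesgue" "B \<in> sets lebesgue"
    and volume: "emeasure lebesgue B \<noteq> 0" "emeasure lebesgue B < top"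
    and finite: "abs_norm f < top"
    and A: "morrey_norm p \<phi> w (indicator B) * kothe_norm (morrey_norm p \<phi> w) (indicator B)
      \<le> ennreal C * emeasure lebesgue B"
  shows "morrey_norm p \<phi> w (indicator B) * average lebesgue B (\<lambda>x. ennreal \<bar>f x\<bar>)
    \<le> ennreal C * abs_norm f"
proof -
  let ?X = "morrey_norm p \<phi> w (indicator B)" and ?N = "abs_norm f"
  let ?I = "\<integral>\<^sup>+x\<in>B. ennreal \<bar>f x\<bar> \<partial>lebesgue"
  have "?X * ?I \<le> ?N * (ennreal C * emeasure lebesgue B)"
  proof (rule ennreal_le_mult_if_greater_imp[OF finite])
    show "ennreal C * emeasure lebesgue B < top"
      using volume(2) by (simp add: ennreal_mult_less_top)
    fix l assume l: "?N < ennreal l"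
    then have "0 < l" by (metis ennreal_neg not_less not_less_zero)
    have "?I \<le> ennreal l * kothe_norm (morrey_norm p \<phi> w) (indicator B)"
      unfolding nn_integral_abs_mult_indicator[symmetric]
      using l \<open>0 < l\<close> by (intro nn_integral_le_mult_kothe_norm) auto
    then have "?X * ?I \<le> ?X * (ennreal l * kothe_norm (morrey_norm p \<phi> w) (indicator B))"
      by (rule mult_left_mono) simp
    also have "\<dots> = ennreal l * (?X * kothe_norm (morrey_norm p \<phi> w) (indicator B))"
      by (rule mult.left_commute)
    also have "\<dots> \<le> ennreal l * (ennreal C * emeasure lebesgue B)"
      by (rule mult_left_mono[OF A]) simp
    finally show "?X * ?I \<le> ennreal l * (ennreal C * emeasure lebesgue B)" .
  qed
  then have "?X * ?I / emeasure lebesgue B \<le> ennreal C * ?N"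
    by (simp only: ennreal_divide_le_iff[OF volume] mult.assoc mult.commute mult.left_commute)
  then show ?thesis by (simp only: average_def ennreal_times_divide)
qed

end

lemma A_morrey_iff:
  "A_morrey p \<phi> w \<longleftrightarrow> (\<exists>C. \<forall>c r. 0 < r \<longrightarrow>
    morrey_norm p \<phi> w (indicator (ball c r)) * kothe_norm (morrey_norm p \<phi> w) (indicator (ball c r))
      \<le> ennreal C * emeasure lebesgue (ball c r))"
  unfolding A_morrey_def by (simp only: ennreal_indicator)

lemma phi_admissible_imp_weighted_morrey:
  "0 < p \<Longrightarrow> weight w \<Longrightarrow> phi_admissible p \<phi> w \<Longrightarrow> weighted_morrey p \<phi> w"
  by unfold_locales (auto simp: phi_admissible_def weightD)

lemma phi_admissible_imp_morrey_norm_indicator_less_top: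
  "phi_admissible p \<phi> w \<Longrightarrow> 0 < r \<Longrightarrow> morrey_norm p \<phi> w (indicator (ball c r)) < top"
  by (simp add: phi_admissible_def ennreal_indicator)

lemma (in weighted_morrey) A_morrey_imp_average_le:
  assumes "A_morrey p \<phi> w"
  obtains A where "\<And>f c r. f \<in> borel_measurable lebesgue \<Longrightarrow> abs_norm f < top \<Longrightarrow> 0 < r \<Longrightarrow>
    ball_norm c r * average lebesgue (ball c r) (\<lambda>x. ennreal \<bar>f x\<bar>) \<le> ennreal A * abs_norm f"
proof -
  obtain A where A: "\<And>c r. 0 < r \<Longrightarrow>
      ball_norm c r * kothe_norm (morrey_norm p \<phi> w) (indicator (ball c r))
      \<le> ennreal A * emeasure lebesgue (ball c r)"
    using assms unfolding A_morrey_iff by blast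
  show ?thesis
    by (rule that[of A], intro morrey_norm_indicator_mult_average_le A sets_lebesgue_ball
        emeasure_lebesgue_ball_nonzero emeasure_lebesgue_ball_less_top)
qed

section \<open>Necessity\<close>

lemma average_le_hl_max:
  "0 < r \<Longrightarrow> x \<in> ball c r \<Longrightarrow> average lebesgue (ball c r) (\<lambda>x. ennreal \<bar>f x\<bar>) \<le> hl_max f x"
  unfolding hl_max_eq_ball_maximal by (rule average_le_ball_maximal) auto

lemma (in weighted_morrey) average_mult_morrey_norm_indicator_le_weak_morrey_norm:
  assumes [measurable]: "f \<in> borel_measurable lebesgue" and r: "0 < r"
    and finite: "ball_norm c r < top"
  shows "average lebesgue (ball c r) (\<lambda>x. ennreal \<bar>f x\<bar>) * ball_norm c r
    \<le> weak_morrey_norm p \<phi> w (hl_max f)"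
proof (rule ennreal_mult_le_if_less_imp[OF finite])
  fix s assume s: "s < average lebesgue (ball c r) (\<lambda>x. ennreal \<bar>f x\<bar>)"
  then obtain t where t: "s = ennreal t" "0 \<le> t" by (cases s) auto
  show "s * ball_norm c r \<le> weak_morrey_norm p \<phi> w (hl_max f)"
  proof (cases "t = 0")
    case False
    show ?thesis
      unfolding t(1)
    proof (rule mult_morrey_norm_indicator_le_weak_morrey_norm)
      show "ennreal t < hl_max f x" if "x \<in> ball c r" for x
        using s average_le_hl_max[OF r that, of f] unfolding t(1) by (rule less_le_trans)
    qed (use False t in auto)
  qed (simp add: t)
qed

lemma (in weighted_morrey) morrey_norm_indicator_mult_kothe_norm_le:
  assumes r: "0 < r" and finite: "ball_norm c r < top"
    and weak: "\<And>f. f \<in> borel_measurable lebesgue \<Longrightarrow> abs_norm f \<le> 1 \<Longrightarrow>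
      weak_morrey_norm p \<phi> w (hl_max f) \<le> K"
  shows "ball_norm c r * kothe_norm (morrey_norm p \<phi> w) (indicator (ball c r))
    \<le> K * emeasure lebesgue (ball c r)"
proof -
  let ?B = "ball c r" and ?A = "\<lambda>f. average lebesgue (ball c r) (\<lambda>x. ennreal \<bar>f x\<bar>)"
  have "ball_norm c r * (\<integral>\<^sup>+x. ennreal \<bar>f x * indicator ?B x\<bar> \<partial>lebesgue) \<le> K * emeasure lebesgue ?B"
    if f: "f \<in> borel_measurable lebesgue" and le: "abs_norm f \<le> 1" for f
  proof -
    have "(\<integral>\<^sup>+x. ennreal \<bar>f x * indicator ?B x\<bar> \<partial>lebesgue) = ?A f * emeasure lebesgue ?B"
      unfolding nn_integral_abs_mult_indicator
      by (intro average_mult_emeasure[symmetric] emeasure_lebesgue_ball_nonzero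
          emeasure_lebesgue_ball_less_top r)
    then have "ball_norm c r * (\<integral>\<^sup>+x. ennreal \<bar>f x * indicator ?B x\<bar> \<partial>lebesgue)
        = ?A f * ball_norm c r * emeasure lebesgue ?B"
      by (simp only: ac_simps)
    also have "\<dots> \<le> K * emeasure lebesgue ?B"
      using average_mult_morrey_norm_indicator_le_weak_morrey_norm[OF f r finite] weak[OF f le]
      by (intro mult_right_mono) (rule order_trans, auto)
    finally show ?thesis .
  qed
  then show ?thesis
    unfolding kothe_norm_def SUP_mult_left_ennreal by (intro SUP_least) auto
qed

theorem M_bdd_weak_imp_A_morrey:
  assumes p: "0 < p" and w: "weight w" and adm: "phi_admissible p \<phi> w" and M: "M_bdd_weak p \<phi> w"
  shows "A_morrey p \<phi> w"
proof -
  interpret weighted_morrey p \<phi> w by (rule phi_admissible_imp_weighted_morrey[OF p w adm])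
  obtain C where C: "\<And>f. f \<in> borel_measurable lebesgue \<Longrightarrow> abs_norm f < \<infinity> \<Longrightarrow>
      weak_morrey_norm p \<phi> w (hl_max f) \<le> ennreal C * abs_norm f"
    using M unfolding M_bdd_weak_def by blast
  have weak: "weak_morrey_norm p \<phi> w (hl_max f) \<le> ennreal C"
    if f: "f \<in> borel_measurable lebesgue" and le: "abs_norm f \<le> 1" for f
  proof -
    have "weak_morrey_norm p \<phi> w (hl_max f) \<le> ennreal C * abs_norm f"
      using le by (intro C f) (auto simp: order_le_less_trans)
    also have "\<dots> \<le> ennreal C * 1" by (rule mult_left_mono[OF le]) simp
    finally show ?thesis by simp
  qed
  have "ball_norm c r * kothe_norm (morrey_norm p \<phi> w) (indicator (ball c r))
      \<le> ennreal C * emeasure lebesgue (ball c r)" if "0 < r" for c r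
    by (intro morrey_norm_indicator_mult_kothe_norm_le weak that
        phi_admissible_imp_morrey_norm_indicator_less_top[OF adm])
  then show ?thesis unfolding A_morrey_iff by blast
qed

section \<open>Sufficiency\<close>

lemma average_lebesgue_le_average_dilate:
  fixes c :: "'a::euclidean_space"
  assumes r: "0 < r" and k: "1 \<le> k"
  shows "average lebesgue (ball c r) g
      \<le> ennreal (k ^ DIM('a)) * average lebesgue (ball c (k * r)) g"
proof -
  have kr: "0 < k * r" using r k by simp
  have "ball c r \<subseteq> ball c (k * r)" using r k by (intro subset_ball) simp
  then have "(\<integral>\<^sup>+y\<in>ball c r. g y \<partial>lebesgue) \<le> (\<integral>\<^sup>+y\<in>ball c (k * r). g y \<partial>lebesgue)"
    by (intro nn_integral_mono) (auto simp: indicator_def)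
  also have "\<dots> = average lebesgue (ball c (k * r)) g * emeasure lebesgue (ball c (k * r))"
    by (intro average_mult_emeasure[symmetric] emeasure_lebesgue_ball_nonzero
        emeasure_lebesgue_ball_less_top kr)
  also have "emeasure lebesgue (ball c (k * r))
      = ennreal (k ^ DIM('a)) * emeasure lebesgue (ball c r)"
    using r k by (intro emeasure_lebesgue_ball_dilate) auto
  finally show ?thesis
    unfolding average_def[of _ "ball c r"]
      ennreal_divide_le_iff[OF emeasure_lebesgue_ball_nonzero[OF r] emeasure_lebesgue_ball_less_top]
    by (simp only: ac_simps)
qed

lemma ball_subset_ball_triple:
  assumes "x \<in> ball c r" "x \<in> ball b s" "r \<le> s"
  shows "ball c r \<subseteq> ball b (3 * s)"
proof
  fix y assume "y \<in> ball c r"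
  then show "y \<in> ball b (3 * s)"
    using assms dist_triangle[of b y x] dist_triangle[of x y c] by (simp add: dist_commute)
qed

lemma local_balls_if_intersect:
  assumes c: "(c, r) \<in> local_balls (\<kappa> / 2) a" and \<kappa>: "0 < \<kappa>" "\<kappa> \<le> 1 / 2"
    and x: "x \<in> ball c r" "x \<in> ball b s" and s: "0 < s" "s < r"
  shows "(b, s) \<in> local_balls \<kappa> a"
proof -
  have r: "0 < r" "2 * r < \<kappa> * dist c a" using c by (auto simp: local_balls_def)
  have "dist c a \<le> 2 * r + dist b a"
    using x s dist_triangle[of c a x] dist_triangle[of x a b] by (simp add: dist_commute)
  then have "\<kappa> * dist c a \<le> \<kappa> * (2 * r) + \<kappa> * dist b a"
    using \<kappa> by (simp flip: distrib_left)
  moreover have "\<kappa> * (2 * r) \<le> r" using mult_right_mono[OF \<kappa>(2), of "2 * r"] r by simp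
  ultimately have "s < \<kappa> * dist b a" using r s by linarith
  then show ?thesis using s by (simp add: local_balls_def)
qed

definition charged_local_balls ::
  "('a::euclidean_space \<Rightarrow> real) \<Rightarrow> real \<Rightarrow> 'a \<Rightarrow> real \<Rightarrow> ('a \<times> real) set" where
  "charged_local_balls w \<kappa> a R =
    {(c, r). (c, r) \<in> local_balls \<kappa> a \<and> r \<le> R \<and> emeasure (weight_measure w) (ball c r) \<noteq> 0}"

lemma (in weighted_morrey) average_le_if_subset_triple:
  assumes s: "0 < s" and sub: "ball c r \<subseteq> ball b (3 * s)"
    and le: "ball_norm b (3 * s) * average lebesgue (ball b (3 * s)) g \<le> E"
    and norm: "ball_norm c r \<noteq> 0" "ball_norm c r < top"
  shows "average lebesgue (ball b s) g \<le> ennreal (3 ^ DIM('a)) * E / ball_norm c r"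
proof -
  have "ball_norm c r \<le> ball_norm b (3 * s)" using sub by (intro morrey_norm_mono) (auto simp: indicator_def)
  then have "average lebesgue (ball b s) g * ball_norm c r
      \<le> (ennreal (3 ^ DIM('a)) * average lebesgue (ball b (3 * s)) g) * ball_norm b (3 * s)"
    using s by (intro mult_mono average_lebesgue_le_average_dilate) auto
  also have "\<dots> = ennreal (3 ^ DIM('a)) * (ball_norm b (3 * s) * average lebesgue (ball b (3 * s)) g)"
    by (simp only: ac_simps)
  also have "\<dots> \<le> ennreal (3 ^ DIM('a)) * E" by (rule mult_left_mono[OF le]) simp
  finally show ?thesis using norm by (simp add: ennreal_le_divide_iff)
qed

text \<open>Three times a ball that meets \<open>ball c r\<close> and is not smaller contains \<open>ball c r\<close>, so the average
  over it is controlled by \<open>avg\<close>; a smaller ball is local and only sees \<open>f\<close> near \<open>ball c r\<close>.\<close>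

lemma (in weighted_morrey) hl_max_le_max_local_maximal:
  fixes f :: "'a \<Rightarrow> real"
  assumes avg: "\<And>c r. 0 < r \<Longrightarrow> ball_norm c r *
      average lebesgue (ball c r) (\<lambda>y. ennreal \<bar>f y\<bar>) \<le> E"
    and \<kappa>: "0 < \<kappa>" "\<kappa> \<le> 1 / 2" and c: "(c, r) \<in> local_balls (\<kappa> / 2) a"
    and norm: "ball_norm c r \<noteq> 0" "ball_norm c r < top"
    and x: "x \<in> ball c r" and charged: "\<And>b s. x \<in> ball b s \<Longrightarrow> emeasure \<mu> (ball b s) \<noteq> 0"
  shows "hl_max f x \<le> max (ennreal (3 ^ DIM('a)) * E / ball_norm c r)
    (ball_maximal lebesgue (charged_local_balls w \<kappa> a r)
      (\<lambda>y. ennreal \<bar>f y\<bar> * indicator (ball c (4 * r)) y) x)"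
    (is "_ \<le> max ?q (ball_maximal _ ?F ?g _)")
  unfolding hl_max_eq_ball_maximal ball_maximal_le_iff
proof (intro allI impI, elim conjE)
  fix b s assume "(b, s) \<in> {(c :: 'a, r :: real). 0 < r}" and xs: "x \<in> ball b s"
  then have s: "0 < s" by simp
  show "average lebesgue (ball b s) (\<lambda>y. ennreal \<bar>f y\<bar>) \<le> max ?q (ball_maximal lebesgue ?F ?g x)"
  proof (cases "s < r")
    case True
    have "ball b s \<subseteq> ball c (3 * r)" using xs x True by (intro ball_subset_ball_triple) auto
    also have "\<dots> \<subseteq> ball c (4 * r)" using True s by (intro subset_ball) simp
    finally have "average lebesgue (ball b s) (\<lambda>y. ennreal \<bar>f y\<bar>) \<le> average lebesgue (ball b s) ?g"
      by (intro average_mono) (auto simp: indicator_def)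
    also have "\<dots> \<le> ball_maximal lebesgue ?F ?g x"
      using local_balls_if_intersect[OF c \<kappa> x xs s True] True charged[OF xs] xs
      by (intro average_le_ball_maximal) (auto simp: charged_local_balls_def)
    finally show ?thesis by (simp add: le_max_iff_disj)
  next
    case False
    then have "average lebesgue (ball b s) (\<lambda>y. ennreal \<bar>f y\<bar>) \<le> ?q"
      using s x xs norm by (intro average_le_if_subset_triple avg ball_subset_ball_triple) auto
    then show ?thesis by (simp add: le_max_iff_disj)
  qed
qed

text \<open>Strong and weak type bounds are treated together: \<open>\<Phi>\<close> is the \<open>p\<close>-th power for the former, and
  \<open>t\<close> times the indicator of \<open>{t<..}\<close> for the latter.\<close>

definition maximal_gauge ::
  "real \<Rightarrow> ('a::euclidean_space \<Rightarrow> real) \<Rightarrow> real \<Rightarrow> 'a \<Rightarrow> ennreal \<Rightarrow> (ennreal \<Rightarrow> ennreal) \<Rightarrow> bool" where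
  "maximal_gauge p w \<kappa> a K \<Phi> \<longleftrightarrow> mono \<Phi> \<and> \<Phi> \<in> borel_measurable borel \<and> (\<forall>y. \<Phi> y \<le> enn_pow p y) \<and>
    (\<forall>R g. g \<in> borel_measurable lebesgue \<longrightarrow>
      (\<integral>\<^sup>+x. \<Phi> (ball_maximal lebesgue (charged_local_balls w \<kappa> a R) g x) \<partial>weight_measure w)
        \<le> K * (\<integral>\<^sup>+x. enn_pow p (g x) \<partial>weight_measure w))"

lemma charged_family_charged_local_balls:
  "weight w \<Longrightarrow> charged_family w (charged_local_balls w \<kappa> a R) R"
  by unfold_locales (auto simp: charged_local_balls_def local_balls_def)

lemma local_balls_dilate:
  assumes "(c, r) \<in> local_balls (\<kappa> / 5) a"
  shows "(c, r) \<in> local_balls \<kappa> a" "(c, 5 * r) \<in> local_balls \<kappa> a"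
  using assms by (auto simp: local_balls_def)

lemma maximal_gauge_enn_pow:
  fixes w :: "'a::euclidean_space \<Rightarrow> real"
  assumes w: "weight w" and p: "1 < p"
    and A_p: "\<And>c r. (c, r) \<in> local_balls \<kappa> a \<Longrightarrow> muckenhoupt p C w (ball c r)"
  shows "maximal_gauge p w (\<kappa> / 5) a (A_p_maximal_const p C DIM('a)) (enn_pow p)"
  unfolding maximal_gauge_def
proof (intro conjI allI impI)
  fix R and g :: "'a \<Rightarrow> ennreal" assume g: "g \<in> borel_measurable lebesgue"
  let ?F = "charged_local_balls w (\<kappa> / 5) a R"
  interpret charged_family w ?F R by (rule charged_family_charged_local_balls[OF w])
  interpret muckenhoupt_family w ?F R p C
    by unfold_locales
      (auto simp: p charged_local_balls_def intro: A_p[OF local_balls_dilate(1)] A_p[OF local_balls_dilate(2)])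
  show "(\<integral>\<^sup>+x. enn_pow p (ball_maximal lebesgue ?F g x) \<partial>weight_measure w)
      \<le> A_p_maximal_const p C DIM('a) * (\<integral>\<^sup>+x. enn_pow p (g x) \<partial>weight_measure w)"
    by (rule ball_maximal_strong_type[OF g])
qed (use p in \<open>auto simp: mono_def enn_pow_mono\<close>)

lemma maximal_gauge_superlevel:
  fixes w :: "'a::euclidean_space \<Rightarrow> real"
  assumes w: "weight w" and A_1: "\<And>c r. (c, r) \<in> local_balls \<kappa> a \<Longrightarrow> muckenhoupt_1 C w (ball c r)"
  shows "maximal_gauge 1 w (\<kappa> / 5) a (ennreal C * ennreal (5 ^ DIM('a)) * ennreal C)
    (\<lambda>y. t * indicator {t<..} y)"
  unfolding maximal_gauge_def
proof (intro conjI allI impI)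
  fix R and g :: "'a \<Rightarrow> ennreal" assume g: "g \<in> borel_measurable lebesgue"
  let ?F = "charged_local_balls w (\<kappa> / 5) a R"
  interpret charged_family w ?F R by (rule charged_family_charged_local_balls[OF w])
  interpret muckenhoupt_1_family w ?F R C
    by unfold_locales
      (auto simp: charged_local_balls_def intro: A_1[OF local_balls_dilate(1)] A_1[OF local_balls_dilate(2)])
  have "(\<integral>\<^sup>+x. t * indicator {t<..} (ball_maximal lebesgue ?F g x) \<partial>weight_measure w)
      = (\<integral>\<^sup>+x. t * indicator {x. t < ball_maximal lebesgue ?F g x} x \<partial>weight_measure w)"
    by (intro nn_integral_cong) (simp add: indicator_def)
  also have "\<dots> = t * emeasure (weight_measure w) {x. t < ball_maximal lebesgue ?F g x}"
    by (simp add: nn_integral_cmult_indicator)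
  also have "\<dots> \<le> ennreal C * ennreal (5 ^ DIM('a)) * ennreal C * (\<integral>\<^sup>+x. g x \<partial>weight_measure w)"
    by (rule ball_maximal_weak_type[OF g])
  finally show "(\<integral>\<^sup>+x. t * indicator {t<..} (ball_maximal lebesgue ?F g x) \<partial>weight_measure w)
      \<le> ennreal C * ennreal (5 ^ DIM('a)) * ennreal C * (\<integral>\<^sup>+x. enn_pow 1 (g x) \<partial>weight_measure w)"
    by simp
qed (auto simp: mono_def indicator_def)

locale admissible_morrey = weighted_morrey p \<phi> w + ball_growth \<phi> D C \<eta>
  for p :: real and \<phi> :: "'a::euclidean_space set \<Rightarrow> real" and w :: "'a \<Rightarrow> real" and D C \<eta> :: real +
  assumes w: "weight w"
    and indicator_less_top: "\<And>c r. 0 < r \<Longrightarrow> morrey_norm p \<phi> w (indicator (ball c r)) < top"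
begin

lemma nn_integral_dilate_le:
  assumes g[measurable]: "g \<in> borel_measurable lebesgue" and r: "0 < r"
  shows "(\<integral>\<^sup>+x. enn_pow p (g x * indicator (ball c (4 * r)) x) \<partial>\<mu>)
    \<le> ennreal (D ^ 2) * enn_pow p (morrey_norm p \<phi> w g) * ennreal (\<phi> (ball c r))"
proof -
  have "(\<integral>\<^sup>+x. enn_pow p (g x * indicator (ball c (4 * r)) x) \<partial>\<mu>)
      = (\<integral>\<^sup>+x\<in>ball c (4 * r). enn_pow p (g x) \<partial>\<mu>)"
    by (simp add: enn_pow_mult)
  also have "\<dots> \<le> ennreal (\<phi> (ball c (4 * r))) * enn_pow p (morrey_norm p \<phi> w g)"
    using r by (intro set_nn_integral_le_morrey_norm g) simp
  also have "\<dots> \<le> ennreal (D ^ 2 * \<phi> (ball c r)) * enn_pow p (morrey_norm p \<phi> w g)"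
    using doubling_iterate[OF r, of c 2] by (intro mult_right_mono ennreal_leI) auto
  also have "\<dots> = ennreal (D ^ 2) * enn_pow p (morrey_norm p \<phi> w g) * ennreal (\<phi> (ball c r))"
    using phi_pos[OF r, of c] by (simp add: ennreal_mult ac_simps)
  finally show ?thesis .
qed

lemma enn_pow_divide_mult_emeasure_le:
  assumes r: "0 < r"
  shows "enn_pow p (E / ball_norm c r) * emeasure \<mu> (ball c r)
    \<le> enn_pow p E * ennreal (\<phi> (ball c r))"
proof (cases "ball_norm c r = 0")
  case True
  then show ?thesis using emeasure_ball_le_morrey_norm_indicator[OF r, of c] by simp
next
  case False
  let ?X = "ball_norm c r"
  have "enn_pow p (E / ?X) * emeasure \<mu> (ball c r)
      \<le> enn_pow p (E / ?X) * (ennreal (\<phi> (ball c r)) * enn_pow p ?X)"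
    by (rule mult_left_mono[OF emeasure_ball_le_morrey_norm_indicator[OF r]]) simp
  also have "\<dots> = enn_pow p (E / ?X * ?X) * ennreal (\<phi> (ball c r))"
    by (simp add: enn_pow_mult ac_simps)
  also have "E / ?X * ?X = E"
    by (rule ennreal_divide_mult_cancel[OF False indicator_less_top[OF r]])
  finally show ?thesis .
qed

lemma AE_gauge_hl_max_le:
  fixes f :: "'a \<Rightarrow> real"
  assumes avg: "\<And>c r. 0 < r \<Longrightarrow> ball_norm c r *
      average lebesgue (ball c r) (\<lambda>y. ennreal \<bar>f y\<bar>) \<le> E"
    and gauge: "maximal_gauge p w \<kappa> a K \<Phi>" and \<kappa>: "0 < \<kappa>" "\<kappa> \<le> 1 / 2"
    and c: "(c, r) \<in> local_balls (\<kappa> / 2) a" and charged: "emeasure \<mu> (ball c r) \<noteq> 0"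
  shows "AE x in \<mu>. x \<in> ball c r \<longrightarrow> \<Phi> (hl_max f x) \<le>
    enn_pow p (ennreal (3 ^ DIM('a)) * E / ball_norm c r) +
    \<Phi> (ball_maximal lebesgue (charged_local_balls w \<kappa> a r)
      (\<lambda>y. ennreal \<bar>f y\<bar> * indicator (ball c (4 * r)) y) x)"
proof -
  have \<Phi>: "mono \<Phi>" and \<Phi>_le: "\<And>y. \<Phi> y \<le> enn_pow p y"
    using gauge by (auto simp: maximal_gauge_def)
  have \<Phi>_max: "\<Phi> (max y z) \<le> enn_pow p y + \<Phi> z" for y z
    using \<Phi>_le[of y] by (simp add: max_def add_increasing add_increasing2)
  have r: "0 < r" using c by (simp add: local_balls_def)
  have norm: "ball_norm c r \<noteq> 0" "ball_norm c r < top"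
    using emeasure_ball_le_morrey_norm_indicator[OF r, of c] charged indicator_less_top[OF r]
    by auto
  have "AE x in \<mu>. \<forall>b s. x \<in> ball b s \<longrightarrow> emeasure \<mu> (ball b s) \<noteq> 0"
    by (rule AE_all_balls_charged) simp
  then show ?thesis
  proof eventually_elim
    fix x assume "\<forall>b s. x \<in> ball b s \<longrightarrow> emeasure \<mu> (ball b s) \<noteq> 0"
    then show "x \<in> ball c r \<longrightarrow> \<Phi> (hl_max f x) \<le>
        enn_pow p (ennreal (3 ^ DIM('a)) * E / ball_norm c r) +
        \<Phi> (ball_maximal lebesgue (charged_local_balls w \<kappa> a r)
          (\<lambda>y. ennreal \<bar>f y\<bar> * indicator (ball c (4 * r)) y) x)"
      by (intro impI order_trans[OF monoD[OF \<Phi>] \<Phi>_max]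
          hl_max_le_max_local_maximal[OF avg \<kappa> c norm]) auto
  qed
qed

lemma nn_integral_gauge_hl_max_local_ball_le:
  fixes f :: "'a \<Rightarrow> real"
  defines "N \<equiv> abs_norm f"
  assumes f[measurable]: "f \<in> borel_measurable lebesgue"
    and avg: "\<And>c r. 0 < r \<Longrightarrow> ball_norm c r *
      average lebesgue (ball c r) (\<lambda>y. ennreal \<bar>f y\<bar>) \<le> A * N"
    and gauge: "maximal_gauge p w \<kappa> a K \<Phi>" and \<kappa>: "0 < \<kappa>" "\<kappa> \<le> 1 / 2"
    and c: "(c, r) \<in> local_balls (\<kappa> / 2) a"
  shows "(\<integral>\<^sup>+x\<in>ball c r. \<Phi> (hl_max f x) \<partial>\<mu>)
    \<le> (enn_pow p (ennreal (3 ^ DIM('a)) * A) + K * ennreal (D ^ 2))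
      * enn_pow p N * ennreal (\<phi> (ball c r))"
proof (cases "emeasure \<mu> (ball c r) = 0")
  case True
  then show ?thesis by (subst nn_integral_null_set) (auto simp: null_sets_def)
next
  case False
  have [measurable]: "\<Phi> \<in> borel_measurable borel" using gauge by (simp add: maximal_gauge_def)
  have r: "0 < r" using c by (simp add: local_balls_def)
  define q where "q = ennreal (3 ^ DIM('a)) * (A * N) / ball_norm c r"
  define g where "g y = ennreal \<bar>f y\<bar> * indicator (ball c (4 * r)) y" for y
  have g[measurable]: "g \<in> borel_measurable lebesgue" unfolding g_def by measurable
  define M where "M = ball_maximal lebesgue (charged_local_balls w \<kappa> a r) g"
  have [measurable]: "M \<in> borel_measurable lebesgue" unfolding M_def by measurable
  have "AE x in \<mu>. x \<in> ball c r \<longrightarrow> \<Phi> (hl_max f x) \<le> enn_pow p q + \<Phi> (M x)"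
    unfolding q_def M_def g_def by (rule AE_gauge_hl_max_le[OF avg gauge \<kappa> c False])
  then have "(\<integral>\<^sup>+x\<in>ball c r. \<Phi> (hl_max f x) \<partial>\<mu>)
      \<le> (\<integral>\<^sup>+x. enn_pow p q * indicator (ball c r) x + \<Phi> (M x) \<partial>\<mu>)"
    by (intro nn_integral_mono_AE) (auto simp: indicator_def elim!: eventually_mono)
  also have "\<dots> = enn_pow p q * emeasure \<mu> (ball c r) + (\<integral>\<^sup>+x. \<Phi> (M x) \<partial>\<mu>)"
    by (subst nn_integral_add) (auto simp: nn_integral_cmult_indicator)
  also have "\<dots> \<le> enn_pow p (ennreal (3 ^ DIM('a)) * (A * N)) * ennreal (\<phi> (ball c r))
      + K * (ennreal (D ^ 2) * enn_pow p N * ennreal (\<phi> (ball c r)))"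
  proof (rule add_mono)
    show "enn_pow p q * emeasure \<mu> (ball c r)
        \<le> enn_pow p (ennreal (3 ^ DIM('a)) * (A * N)) * ennreal (\<phi> (ball c r))"
      unfolding q_def by (rule enn_pow_divide_mult_emeasure_le[OF r])
    have "(\<integral>\<^sup>+x. \<Phi> (M x) \<partial>\<mu>) \<le> K * (\<integral>\<^sup>+x. enn_pow p (g x) \<partial>\<mu>)"
      using gauge g unfolding maximal_gauge_def M_def by blast
    also have "\<dots> \<le> K * (ennreal (D ^ 2) * enn_pow p N * ennreal (\<phi> (ball c r)))"
      unfolding g_def N_def by (intro mult_left_mono nn_integral_dilate_le r) auto
    finally show "(\<integral>\<^sup>+x. \<Phi> (M x) \<partial>\<mu>)
        \<le> K * (ennreal (D ^ 2) * enn_pow p N * ennreal (\<phi> (ball c r)))" .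
  qed
  also have "\<dots> = (enn_pow p (ennreal (3 ^ DIM('a)) * A) + K * ennreal (D ^ 2))
      * enn_pow p N * ennreal (\<phi> (ball c r))"
    by (simp add: enn_pow_mult distrib_right mult.assoc)
  finally show ?thesis .
qed

lemma local_nn_integral_bound_imp_global_bound:
  assumes \<epsilon>: "0 < \<epsilon>" "\<epsilon> \<le> 1"
  obtains L :: real where "\<And>h K a c r. h \<in> borel_measurable lebesgue \<Longrightarrow>
      (\<And>c r. (c, r) \<in> local_balls \<epsilon> a \<Longrightarrow>
        (\<integral>\<^sup>+x\<in>ball c r. h x \<partial>\<mu>) \<le> K * ennreal (\<phi> (ball c r))) \<Longrightarrow>
      0 < r \<Longrightarrow> (\<integral>\<^sup>+x\<in>ball c r. h x \<partial>\<mu>) \<le> ennreal L * (K * ennreal (\<phi> (ball c r)))"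
proof -
  obtain L where L: "\<And>(\<nu> :: 'a measure) K a c r. sets \<nu> = sets lebesgue \<Longrightarrow> emeasure \<nu> {a} = 0 \<Longrightarrow>
      (\<And>c r. (c, r) \<in> local_balls \<epsilon> a \<Longrightarrow> emeasure \<nu> (ball c r) \<le> K * ennreal (\<phi> (ball c r))) \<Longrightarrow>
      0 < r \<Longrightarrow> emeasure \<nu> (ball c r) \<le> ennreal L * (K * ennreal (\<phi> (ball c r)))"
    by (rule local_bound_imp_global_bound[OF \<epsilon>]) blast+
  show ?thesis
  proof (rule that[of L])
    fix h K a c and r :: real
    assume h[measurable]: "h \<in> borel_measurable lebesgue" and r: "0 < r"
      and le: "\<And>c r. (c, r) \<in> local_balls \<epsilon> a \<Longrightarrow>
        (\<integral>\<^sup>+x\<in>ball c r. h x \<partial>\<mu>) \<le> K * ennreal (\<phi> (ball c r))"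
    define \<nu> where "\<nu> = density \<mu> h"
    have \<nu>: "emeasure \<nu> B = (\<integral>\<^sup>+x\<in>B. h x \<partial>\<mu>)" if "B \<in> sets lebesgue" for B
      unfolding \<nu>_def using that by (subst emeasure_density) auto
    have "emeasure \<nu> {a} = 0"
      using null_sets_weight_measure_singleton[OF borel_w, of a] by (simp add: \<nu> null_setsD1)
    then show "(\<integral>\<^sup>+x\<in>ball c r. h x \<partial>\<mu>) \<le> ennreal L * (K * ennreal (\<phi> (ball c r)))"
      using L[of \<nu> a K r c] le r unfolding \<nu>[OF sets_lebesgue_ball] by (simp add: \<nu>_def)
  qed
qed

lemma maximal_gauge_imp_hl_max_gauge_bound:
  assumes A: "A_morrey p \<phi> w" and \<kappa>: "0 < \<kappa>" "\<kappa> \<le> 1 / 2" and K: "K < top"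
  obtains L where "\<And>\<Phi> a. maximal_gauge p w \<kappa> a K \<Phi> \<Longrightarrow> hl_max_gauge_bound L \<Phi>"
proof -
  obtain A\<^sub>0 where A\<^sub>0: "\<And>f c r. f \<in> borel_measurable lebesgue \<Longrightarrow> abs_norm f < top \<Longrightarrow> 0 < r \<Longrightarrow>
      ball_norm c r * average lebesgue (ball c r) (\<lambda>x. ennreal \<bar>f x\<bar>) \<le> ennreal A\<^sub>0 * abs_norm f"
    by (rule A_morrey_imp_average_le[OF A]) blast
  have half: "0 < \<kappa> / 2" "\<kappa> / 2 \<le> 1" using \<kappa> by auto
  obtain L\<^sub>0 where L\<^sub>0: "\<And>h K a c r. h \<in> borel_measurable lebesgue \<Longrightarrow>
      (\<And>c r. (c, r) \<in> local_balls (\<kappa> / 2) a \<Longrightarrow>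
        (\<integral>\<^sup>+x\<in>ball c r. h x \<partial>\<mu>) \<le> K * ennreal (\<phi> (ball c r))) \<Longrightarrow>
      0 < r \<Longrightarrow> (\<integral>\<^sup>+x\<in>ball c r. h x \<partial>\<mu>) \<le> ennreal L\<^sub>0 * (K * ennreal (\<phi> (ball c r)))"
    by (rule local_nn_integral_bound_imp_global_bound[OF half]) blast+
  define L\<^sub>1 where "L\<^sub>1 = enn_pow p (ennreal (3 ^ DIM('a)) * ennreal A\<^sub>0) + K * ennreal (D ^ 2)"
  have "enn_pow (1 / p) (ennreal L\<^sub>0 * L\<^sub>1) < top"
    using K by (simp add: L\<^sub>1_def ennreal_mult_less_top)
  then obtain L where L: "enn_pow (1 / p) (ennreal L\<^sub>0 * L\<^sub>1) = ennreal L"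
    by (metis ennreal_cases less_irrefl)
  have "hl_max_gauge_bound L \<Phi>" if gauge: "maximal_gauge p w \<kappa> a K \<Phi>" for \<Phi> a
    unfolding hl_max_gauge_bound_def
  proof (intro allI impI)
    fix f :: "'a \<Rightarrow> real" and c :: 'a and r :: real
    assume f[measurable]: "f \<in> borel_measurable lebesgue" and r: "0 < r"
      and finite: "abs_norm f < \<infinity>"
    let ?N = "abs_norm f"
    have [measurable]: "\<Phi> \<in> borel_measurable borel" using gauge by (simp add: maximal_gauge_def)
    have avg: "ball_norm c r * average lebesgue (ball c r) (\<lambda>x. ennreal \<bar>f x\<bar>) \<le> ennreal A\<^sub>0 * ?N"
      if "0 < r" for c r
      using A\<^sub>0[OF f _ that] finite by simp
    have "(\<integral>\<^sup>+x\<in>ball c r. \<Phi> (hl_max f x) \<partial>\<mu>)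
        \<le> ennreal L\<^sub>0 * (L\<^sub>1 * enn_pow p ?N * ennreal (\<phi> (ball c r)))"
      unfolding L\<^sub>1_def
      by (rule L\<^sub>0[OF _ nn_integral_gauge_hl_max_local_ball_le[OF f avg gauge \<kappa>] r]) measurable
    also have "\<dots> = ennreal (\<phi> (ball c r)) * enn_pow p (enn_pow (1 / p) (ennreal L\<^sub>0 * L\<^sub>1) * ?N)"
      using p by (simp add: enn_pow_mult ac_simps)
    finally show "(\<integral>\<^sup>+x\<in>ball c r. \<Phi> (hl_max f x) \<partial>\<mu>)
        \<le> ennreal (\<phi> (ball c r)) * enn_pow p (ennreal L * ?N)"
      unfolding L .
  qed
  then show ?thesis by (rule that)
qed

end

lemma phi_admissible_imp_admissible_morrey:
  fixes \<phi> :: "'a::euclidean_space set \<Rightarrow> real"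
  assumes "0 < p" "weight w" "phi_admissible p \<phi> w"
  obtains D C \<eta> where "admissible_morrey p \<phi> w D C \<eta>"
proof -
  obtain D C \<eta> where "ball_growth \<phi> D C \<eta>" by (rule phi_admissible_imp_ball_growth[OF assms(3)])
  moreover have "weighted_morrey p \<phi> w" by (rule phi_admissible_imp_weighted_morrey[OF assms])
  moreover have "admissible_morrey_axioms p \<phi> w"
    using assms phi_admissible_imp_morrey_norm_indicator_less_top by unfold_locales auto
  ultimately show ?thesis by (intro that admissible_morrey.intro)
qed

theorem A_morrey_imp_M_bdd:
  fixes w :: "'a::euclidean_space \<Rightarrow> real"
  assumes w: "weight w" and \<kappa>: "0 < \<kappa>" "\<kappa> < 1" and exponent: "1 < p"
    and adm: "phi_admissible p \<phi> w" and A: "A_morrey p \<phi> w" and A_p: "A_p_loc \<kappa> p (\<lambda>x. w (x + a))"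
  shows "M_bdd p \<phi> w"
proof -
  obtain D C \<eta> where "admissible_morrey p \<phi> w D C \<eta>"
    using phi_admissible_imp_admissible_morrey[OF _ w adm] exponent by auto
  then interpret admissible_morrey p \<phi> w D C \<eta> .
  obtain B where "\<And>c r. (c, r) \<in> local_balls \<kappa> a \<Longrightarrow> muckenhoupt p B w (ball c r)"
    by (rule A_p_loc_translation[OF borel_w A_p]) blast
  then have gauge: "maximal_gauge p w (\<kappa> / 5) a (A_p_maximal_const p B DIM('a)) (enn_pow p)"
    by (rule maximal_gauge_enn_pow[OF w exponent])
  have fifth: "0 < \<kappa> / 5" "\<kappa> / 5 \<le> 1 / 2" using \<kappa> by auto
  obtain L where "hl_max_gauge_bound L (enn_pow p)"
    by (rule maximal_gauge_imp_hl_max_gauge_bound[OF A fifth A_p_maximal_const_less_top])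
      (use gauge in blast)
  then show ?thesis by (rule M_bdd_if_gauge_bound)
qed

theorem A_morrey_imp_M_bdd_weak:
  fixes w :: "'a::euclidean_space \<Rightarrow> real"
  assumes w: "weight w" and \<kappa>: "0 < \<kappa>" "\<kappa> < 1"
    and adm: "phi_admissible 1 \<phi> w" and A: "A_morrey 1 \<phi> w" and A_1: "A_1_loc \<kappa> (\<lambda>x. w (x + a))"
  shows "M_bdd_weak 1 \<phi> w"
proof -
  obtain D C \<eta> where "admissible_morrey 1 \<phi> w D C \<eta>"
    using phi_admissible_imp_admissible_morrey[OF _ w adm] by auto
  then interpret admissible_morrey 1 \<phi> w D C \<eta> .
  obtain B where "\<And>c r. (c, r) \<in> local_balls \<kappa> a \<Longrightarrow> muckenhoupt_1 B w (ball c r)"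
    by (rule A_1_loc_translation[OF borel_w A_1]) blast
  then have gauge: "maximal_gauge 1 w (\<kappa> / 5) a (ennreal B * ennreal (5 ^ DIM('a)) * ennreal B)
      (\<lambda>y. t * indicator {t<..} y)" for t
    by (rule maximal_gauge_superlevel[OF w])
  have "ennreal B * ennreal (5 ^ DIM('a)) * ennreal B < top" by (simp add: ennreal_mult_less_top)
  moreover have "0 < \<kappa> / 5" "\<kappa> / 5 \<le> 1 / 2" using \<kappa> by auto
  ultimately obtain L where "hl_max_gauge_bound L (\<lambda>y. t * indicator {t<..} y)" for t
    using maximal_gauge_imp_hl_max_gauge_bound[OF A] gauge by metis
  then show ?thesis by (intro M_bdd_weak_if_gauge_bound[of L]) simp
qed

theorem theorem5p1:
  fixes w :: "'a::euclidean_space \<Rightarrow> real" and \<phi> :: "'a set \<Rightarrow> real" and \<kappa> :: real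
  assumes "weight w" and "0 < \<kappa>" and "\<kappa> < 1"
  shows "(\<forall>p. 1 \<le> p \<longrightarrow> phi_admissible p \<phi> w \<longrightarrow> M_bdd_weak p \<phi> w \<longrightarrow> A_morrey p \<phi> w)
    \<and> (\<forall>p. 1 < p \<longrightarrow> phi_admissible p \<phi> w \<longrightarrow> A_morrey p \<phi> w \<longrightarrow>
          (\<exists>a. A_p_loc \<kappa> p (\<lambda>x. w (x + a))) \<longrightarrow> M_bdd p \<phi> w)
    \<and> (phi_admissible 1 \<phi> w \<longrightarrow> A_morrey 1 \<phi> w \<longrightarrow>
          (\<exists>a. A_1_loc \<kappa> (\<lambda>x. w (x + a))) \<longrightarrow> M_bdd_weak 1 \<phi> w)"
proof (intro conjI allI impI; (elim exE)?)
  fix p :: real assume "1 \<le> p" "phi_admissible p \<phi> w" "M_bdd_weak p \<phi> w"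
  then show "A_morrey p \<phi> w" using assms(1) by (intro M_bdd_weak_imp_A_morrey) auto
next
  fix p :: real and a :: 'a
  assume "1 < p" "phi_admissible p \<phi> w" "A_morrey p \<phi> w" "A_p_loc \<kappa> p (\<lambda>x. w (x + a))"
  then show "M_bdd p \<phi> w" by (rule A_morrey_imp_M_bdd[OF assms])
next
  fix a :: 'a
  assume "phi_admissible 1 \<phi> w" "A_morrey 1 \<phi> w" "A_1_loc \<kappa> (\<lambda>x. w (x + a))"
  then show "M_bdd_weak 1 \<phi> w" by (rule A_morrey_imp_M_bdd_weak[OF assms])
qed

end
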